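(* Let $E\subseteq X\times X$ be a nonsmooth aperiodic countable Borel equivalence relation on a standard Borel space $X$, and let $\mathbf{G}=(X,E\setminus\Delta_X)$, where $\Delta_X=\{(x,x):x\in X\}$. Then $D(\mathbf{G})=\aleph_0<2^{\aleph_0}=D_B(\mathbf{G})$.
   Context: A Borel equivalence relation on a standard Borel space $X$ is an equivalence relation $E\subseteq X\times X$ that is a Borel subset of $X\times X$. It is countable if all of its equivalence classes are countable; a countable Borel equivalence relation is aperiodic if all of its equivalence classes are infinite. $E$ is smooth if there exist a standard Borel space $Y$ and a Borel map $f:X\to Y$ such that $x\,E\,y$ if and only if $f(x)=f(y)$ for all $x,y\in X$; nonsmooth means not smooth. $\text{Aut}(\mathbf{G})$ denotes the group of all graph automorphisms of a graph $\mathbf{G}=(X,G)$ with vertex set $X$ and edge relation $G$. A distinguishing coloring of $\mathbf{G}$ is a map $c:X\to I$ into a set $I$ such that for every $\varphi\in\text{Aut}(\mathbf{G})\setminus\{\text{id}\}$ there exists $x\in X$ with $c(x)\neq c(\varphi(x))$ (it need not be a proper vertex coloring). The distinguishing number $D(\mathbf{G})$ is the minimum of the cardinals $|I|$ over all sets $I$ for which there is a distinguishing coloring $c:X\to I$. If $X$ is a standard Borel space and $G\subseteq X\times X$ is Borel, a Borel distinguishing coloring of $\mathbf{G}$ is a distinguishing coloring $c:X\to I$ that is a Borel map into a standard Borel space $I$. The Borel distinguishing number $D_B(\mathbf{G})$ is the minimum of the cardinals $|I|$ over all standard Borel spaces $I$ for which there is a Borel distinguishing coloring $c:X\to I$. 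*)

theory Defs
  imports "HOL-Analysis.Analysis"
begin

unbundle cardinal_syntax

text \<open>Only the underlying measurable space of a \<open>measure\<close> matters below; the measure carried by
  it is ignored.\<close>

definition polish_topology :: "'a topology \<Rightarrow> bool" where
  "polish_topology T \<longleftrightarrow> completely_metrizable_space T \<and> separable_space T"

definition standard_borel :: "'a measure \<Rightarrow> bool" where
  "standard_borel M \<longleftrightarrow>
     (\<exists>T. polish_topology T \<and> topspace T = space M \<and>
          sets M = sigma_sets (topspace T) {U. openin T U})"

definition borel_equiv :: "'a measure \<Rightarrow> 'a rel \<Rightarrow> bool" where
  "borel_equiv M E \<longleftrightarrow> equiv (space M) E \<and> E \<in> sets (M \<Otimes>\<^sub>M M)"

definition countable_borel_equiv :: "'a measure \<Rightarrow> 'a rel \<Rightarrow> bool" where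
  "countable_borel_equiv M E \<longleftrightarrow> borel_equiv M E \<and> (\<forall>C \<in> space M // E. countable C)"

definition aperiodic :: "'a measure \<Rightarrow> 'a rel \<Rightarrow> bool" where
  "aperiodic M E \<longleftrightarrow> (\<forall>C \<in> space M // E. infinite C)"

text \<open>A standard Borel space has at most continuum many points, so up to isomorphism its points are
  reals. Hence it suffices to let \<open>Y\<close> range over standard Borel spaces whose points are reals; the
  lemma \<open>smoothI\<close> below confirms that spaces \<open>Y\<close> on other types give nothing new.\<close>

definition smooth :: "'a measure \<Rightarrow> 'a rel \<Rightarrow> bool" where
  "smooth M E \<longleftrightarrow>
     (\<exists>(Y :: real measure) f. standard_borel Y \<and> f \<in> M \<rightarrow>\<^sub>M Y \<and>
        (\<forall>x \<in> space M. \<forall>y \<in> space M. (x, y) \<in> E \<longleftrightarrow> f x = f y))"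

text \<open>A graph is given by its vertex set \<open>V\<close> and its edge relation \<open>G\<close>. Automorphisms are total
  functions made \<open>undefined\<close> outside \<open>V\<close>, so that the identity automorphism is
  \<open>\<lambda>x\<in>V. x\<close>.\<close>

definition graph_Aut :: "'a set \<Rightarrow> 'a rel \<Rightarrow> ('a \<Rightarrow> 'a) set" where
  "graph_Aut V G = {\<phi> \<in> extensional V. bij_betw \<phi> V V \<and>
     (\<forall>x \<in> V. \<forall>y \<in> V. (x, y) \<in> G \<longleftrightarrow> (\<phi> x, \<phi> y) \<in> G)}"

definition distinguishing_coloring :: "'a set \<Rightarrow> 'a rel \<Rightarrow> ('a \<Rightarrow> 'i) \<Rightarrow> bool" where
  "distinguishing_coloring V G c \<longleftrightarrow>
     (\<forall>\<phi> \<in> graph_Aut V G - {\<lambda>x\<in>V. x}. \<exists>x \<in> V. c x \<noteq> c (\<phi> x))"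

definition min_card :: "'i set set \<Rightarrow> 'i rel" where
  "min_card \<I> = |SOME I. I \<in> \<I> \<and> (\<forall>J \<in> \<I>. |I| \<le>o |J| )|"

text \<open>Color sets are taken from the type of the vertices. Since \<open>V\<close> itself admits a distinguishing
  coloring (the identity), larger color sets are irrelevant for the minimum; see the lemmas
  \<open>distinguishing_number_attained\<close> and \<open>distinguishing_number_le\<close>, the latter for color sets of
  arbitrary type.\<close>

definition distinguishing_number :: "'a set \<Rightarrow> 'a rel \<Rightarrow> 'a rel" where
  "distinguishing_number V G =
     min_card {I. \<exists>c. c \<in> V \<rightarrow> I \<and> distinguishing_coloring V G c}"

text \<open>As for \<open>smooth\<close>, color spaces may be assumed to consist of reals; see the lemmas
  \<open>borel_distinguishing_number_attained\<close> and \<open>borel_distinguishing_number_le\<close>.\<close>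

definition borel_distinguishing_number :: "'a measure \<Rightarrow> 'a rel \<Rightarrow> real rel" where
  "borel_distinguishing_number M G =
     min_card {space N | N. standard_borel N \<and>
       (\<exists>c. c \<in> M \<rightarrow>\<^sub>M N \<and> distinguishing_coloring (space M) G c)}"

lemma min_card:
  assumes "I \<in> \<I>"
  shows min_card_attained: "\<exists>J \<in> \<I>. min_card \<I> = |J|"
    and min_card_le: "min_card \<I> \<le>o |I|"
proof -
  have "\<exists>r \<in> card_of ` \<I>. \<forall>r' \<in> card_of ` \<I>. r \<le>o r'"
    using assms by (intro exists_minim_Card_order) (auto simp: card_of_Card_order)
  then have ex: "\<exists>J. J \<in> \<I> \<and> (\<forall>K \<in> \<I>. |J| \<le>o |K| )"
    by auto
  show "\<exists>J \<in> \<I>. min_card \<I> = |J|" "min_card \<I> \<le>o |I|"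
    using someI_ex[OF ex] assms by (auto simp: min_card_def)
qed

lemma graph_Aut_in: "\<phi> \<in> graph_Aut V G \<Longrightarrow> x \<in> V \<Longrightarrow> \<phi> x \<in> V"
  by (auto simp: graph_Aut_def bij_betw_def)

lemma distinguishing_coloring_comp:
  assumes "distinguishing_coloring V G c" "c \<in> V \<rightarrow> A" "inj_on f A"
  shows "distinguishing_coloring V G (\<lambda>x. f (c x))"
  unfolding distinguishing_coloring_def
proof
  fix \<phi> assume \<phi>: "\<phi> \<in> graph_Aut V G - {\<lambda>x\<in>V. x}"
  then obtain x where x: "x \<in> V" "c x \<noteq> c (\<phi> x)"
    using assms(1) unfolding distinguishing_coloring_def by blast
  moreover have "c x \<in> A" "c (\<phi> x) \<in> A"
    using funcset_mem[OF assms(2)] graph_Aut_in[of \<phi> V G x] x(1) \<phi> by simp_all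
  ultimately have "f (c x) \<noteq> f (c (\<phi> x))"
    by (simp add: inj_on_eq_iff[OF assms(3)])
  with x(1) show "\<exists>x \<in> V. f (c x) \<noteq> f (c (\<phi> x))" ..
qed

lemma distinguishing_coloring_inj:
  assumes "inj_on f V"
  shows "distinguishing_coloring V G f"
  unfolding distinguishing_coloring_def
proof (rule ballI, rule ccontr)
  fix \<phi> assume \<phi>: "\<phi> \<in> graph_Aut V G - {\<lambda>x\<in>V. x}"
  assume "\<not> (\<exists>x\<in>V. f x \<noteq> f (\<phi> x))"
  then have "\<phi> x = x" if "x \<in> V" for x
    using assms that \<phi> graph_Aut_in[of \<phi> V G x] by (metis DiffD1 inj_onD)
  moreover have "\<phi> \<in> extensional V"
    using \<phi> by (auto simp: graph_Aut_def)
  ultimately have "\<phi> = (\<lambda>x\<in>V. x)"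
    by (auto simp: fun_eq_iff extensional_def)
  then show False using \<phi> by auto
qed

lemma distinguishing_number_attained:
  "\<exists>I c. distinguishing_number V G = |I| \<and> c \<in> V \<rightarrow> I \<and> distinguishing_coloring V G c"
proof -
  have "V \<in> {I. \<exists>c. c \<in> V \<rightarrow> I \<and> distinguishing_coloring V G c}"
    using distinguishing_coloring_inj[of "\<lambda>x. x" V G] by (auto intro!: exI[of _ "\<lambda>x. x"])
  from min_card_attained[OF this] show ?thesis
    unfolding distinguishing_number_def by blast
qed

lemma distinguishing_number_le:
  fixes V :: "'a set" and J :: "'i set"
  assumes "c \<in> V \<rightarrow> J" "distinguishing_coloring V G c"
  shows "distinguishing_number V G \<le>o |J|"
proof -
  define g where "g = inv_into V c"
  have g: "inj_on g (c ` V)"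
    unfolding g_def by (rule inj_on_inv_into) simp
  have "distinguishing_coloring V G (\<lambda>x. g (c x))"
    by (rule distinguishing_coloring_comp[OF assms(2) _ g]) simp
  then have "g ` c ` V \<in> {I. \<exists>c. c \<in> V \<rightarrow> I \<and> distinguishing_coloring V G c}"
    by (intro CollectI exI[of _ "\<lambda>x. g (c x)"]) simp
  from min_card_le[OF this] have "distinguishing_number V G \<le>o |g ` c ` V|"
    unfolding distinguishing_number_def .
  also have "|g ` c ` V| \<le>o |c ` V|" by (rule card_of_image)
  also have "|c ` V| \<le>o |J|" using assms(1) by (intro card_of_mono1) auto
  finally show ?thesis .
qed

lemma polish_topology_inj_real:
  assumes "polish_topology T"
  shows "\<exists>f :: 'a \<Rightarrow> real. inj_on f (topspace T)"
proof -
  obtain S d where "Metric_space S d" and T: "T = Metric_space.mtopology S d"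
    using assms unfolding polish_topology_def completely_metrizable_space_def by blast
  interpret Metric_space S d by fact
  obtain C where C: "countable C" "C \<subseteq> S" "mtopology closure_of C = S"
    using assms unfolding polish_topology_def separable_space_def T by auto
  define P where "P x = {(c, n). c \<in> C \<and> d x c < inverse (real (Suc n))}" for x
  define h where "h x = to_nat_on (C \<times> (UNIV :: nat set)) ` P x" for x
  have cnt: "countable (C \<times> (UNIV :: nat set))" and P: "P x \<subseteq> C \<times> UNIV" for x
    using C(1) by (auto simp: P_def)
  have "inj_on h S"
  proof (rule inj_onI, rule ccontr)
    fix x y assume xy: "x \<in> S" "y \<in> S" "h x = h y" "x \<noteq> y"
    have eq: "P x = P y"
      using xy(3) inj_on_to_nat_on[OF cnt] P unfolding h_def by (metis inj_on_image_eq_iff)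
    have "0 < d x y / 2"
      using xy by simp
    then obtain n where n: "inverse (real (Suc n)) < d x y / 2"
      using reals_Archimedean by blast
    have "x \<in> mtopology closure_of C"
      using C(3) xy(1) by simp
    then have "\<forall>r>0. \<exists>c \<in> C. c \<in> mball x r"
      unfolding metric_closure_of by blast
    moreover have "0 < inverse (real (Suc n))"
      by simp
    ultimately obtain c where c: "c \<in> C" "c \<in> mball x (inverse (real (Suc n)))"
      by blast
    then have "(c, n) \<in> P x"
      by (auto simp: P_def)
    then have "d x c < inverse (real (Suc n))" "d y c < inverse (real (Suc n))"
      using eq by (auto simp: P_def)
    moreover have "d x y \<le> d x c + d y c"
      using triangle[of x c y] commute[of c y] xy c C(2) by auto
    ultimately show False
      using n by linarith
  qed
  moreover obtain k :: "nat set \<Rightarrow> real" where "inj k"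
    using nat_sets_eqpoll_reals unfolding eqpoll_def bij_betw_def by blast
  ultimately have "inj_on (k \<circ> h) S"
    by (auto intro: comp_inj_on inj_on_subset)
  then show ?thesis
    unfolding T topspace_mtopology by blast
qed

lemma standard_borel_embed_measure:
  assumes "standard_borel M" "inj_on f (space M)"
  shows "standard_borel (embed_measure M f)"
proof -
  obtain T where T: "polish_topology T" "topspace T = space M"
    "sets M = sigma_sets (topspace T) {U. openin T U}"
    using assms(1) unfolding standard_borel_def by blast
  define g where "g = inv_into (space M) f"
  define T' where "T' = pullback_topology (f ` space M) g T"
  have gf: "g (f x) = x" if "x \<in> space M" for x
    using assms(2) that by (simp add: g_def)
  have top: "topspace T' = f ` space M"
    using T(2) gf by (auto simp: T'_def topspace_pullback_topology)
  have img: "g -` U \<inter> f ` space M = f ` U" if "U \<subseteq> space M" for U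
    using that gf by force
  have op: "openin T' (f ` U) \<longleftrightarrow> openin T U" if U: "U \<subseteq> space M" for U
  proof
    assume "openin T' (f ` U)"
    then obtain W where W: "openin T W" "f ` U = g -` W \<inter> f ` space M"
      unfolding T'_def openin_pullback_topology by blast
    then have "W \<subseteq> space M"
      using openin_subset T(2) by metis
    then have "f ` U = f ` W"
      using W(2) img by simp
    then have "U = W"
      using inj_on_image_eq_iff[OF assms(2) U \<open>W \<subseteq> space M\<close>] by simp
    then show "openin T U" using W(1) by simp
  next
    assume "openin T U"
    then show "openin T' (f ` U)"
      unfolding T'_def openin_pullback_topology using img[OF U] by metis
  qed
  have "homeomorphic_map T T' f"
  proof (rule bijective_open_imp_homeomorphic_map)
    show "inj_on f (topspace T)" "f ` topspace T = topspace T'"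
      using assms(2) T(2) top by auto
    show "open_map T T' f"
      unfolding open_map_def using op openin_subset T(2) by metis
    show "continuous_map T T' f"
      unfolding continuous_map_def
    proof (intro conjI allI impI)
      show "f \<in> topspace T \<rightarrow> topspace T'"
        using T(2) top by auto
      fix W assume "openin T' W"
      then obtain U where U: "openin T U" "W = g -` U \<inter> f ` space M"
        unfolding T'_def openin_pullback_topology by blast
      have "U \<subseteq> space M"
        using openin_subset[OF U(1)] T(2) by simp
      moreover have "f x \<in> W \<longleftrightarrow> x \<in> U" if "x \<in> space M" for x
        using gf[OF that] that by (simp add: U(2))
      ultimately have "{x \<in> topspace T. f x \<in> W} = U"
        using T(2) by blast
      then show "openin T {x \<in> topspace T. f x \<in> W}"
        using U(1) by simp
    qed
  qed
  then have "T homeomorphic_space T'"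
    using homeomorphic_map_imp_homeomorphic_space by blast
  then have "polish_topology T'"
    using T(1) unfolding polish_topology_def
    by (simp add: homeomorphic_completely_metrizable_space homeomorphic_separable_space)
  moreover have "sets (embed_measure M f) = sigma_sets (topspace T') {U. openin T' U}"
  proof -
    have "sets (embed_measure M f) = (`) f ` sets M"
      by (subst sets_embed_measure'[OF assms(2)]) auto
    also have "\<dots> = (\<lambda>A. g -` A \<inter> f ` space M) ` sets M"
    proof (rule image_cong[OF refl])
      fix A assume "A \<in> sets M"
      from sets.sets_into_space[OF this] show "f ` A = g -` A \<inter> f ` space M"
        using gf by force
    qed
    also have "\<dots> = {g -` A \<inter> f ` space M |A. A \<in> sigma_sets (space M) {U. openin T U}}"
      using T(2,3) by auto
    also have "\<dots> = sigma_sets (f ` space M) {g -` A \<inter> f ` space M |A. A \<in> {U. openin T U}}"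
      using gf by (intro sigma_sets_vimage_commute) auto
    also have "{g -` A \<inter> f ` space M |A. A \<in> {U. openin T U}} = {U. openin T' U}"
      by (auto simp: T'_def openin_pullback_topology)
    finally show ?thesis using top by simp
  qed
  ultimately show ?thesis
    unfolding standard_borel_def using top by (auto simp: space_embed_measure)
qed

lemma standard_borel_real_copy:
  assumes "standard_borel M"
  obtains f and N :: "real measure" where
    "standard_borel N" "space N = f ` space M" "inj_on f (space M)" "f \<in> M \<rightarrow>\<^sub>M N"
proof -
  obtain f :: "'a \<Rightarrow> real" where "inj_on f (space M)"
    using assms polish_topology_inj_real unfolding standard_borel_def by metis
  then show ?thesis
    using that[of "embed_measure M f" f] assms
    by (auto simp: standard_borel_embed_measure space_embed_measure measurable_embed_measure2')
qed

lemma smoothI: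
  fixes Y :: "'b measure"
  assumes "standard_borel Y" "f \<in> M \<rightarrow>\<^sub>M Y"
    and "\<And>x y. x \<in> space M \<Longrightarrow> y \<in> space M \<Longrightarrow> (x, y) \<in> E \<longleftrightarrow> f x = f y"
  shows "smooth M E"
proof -
  obtain g and N :: "real measure" where
    N: "standard_borel N" "inj_on g (space Y)" "g \<in> Y \<rightarrow>\<^sub>M N"
    using standard_borel_real_copy[OF assms(1)] by metis
  have "(x, y) \<in> E \<longleftrightarrow> (g \<circ> f) x = (g \<circ> f) y" if "x \<in> space M" "y \<in> space M" for x y
    using assms(3)[OF that] that measurable_space[OF assms(2)] N(2) by (auto dest: inj_onD)
  moreover have "g \<circ> f \<in> M \<rightarrow>\<^sub>M N"
    using assms(2) N(3) by (rule measurable_comp)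
  ultimately show ?thesis
    using N(1) unfolding smooth_def by blast
qed

lemma borel_distinguishing_number_le:
  fixes N :: "'i measure"
  assumes "standard_borel N" "c \<in> M \<rightarrow>\<^sub>M N" "distinguishing_coloring (space M) G c"
  shows "borel_distinguishing_number M G \<le>o |space N|"
proof -
  obtain g and N' :: "real measure" where
    N': "standard_borel N'" "space N' = g ` space N" "inj_on g (space N)" "g \<in> N \<rightarrow>\<^sub>M N'"
    using standard_borel_real_copy[OF assms(1)] by metis
  have "distinguishing_coloring (space M) G (\<lambda>x. g (c x))"
    by (rule distinguishing_coloring_comp[OF assms(3) _ N'(3)]) (simp add: measurable_space[OF assms(2)])
  moreover have "(\<lambda>x. g (c x)) \<in> M \<rightarrow>\<^sub>M N'"
    using measurable_comp[OF assms(2) N'(4)] by (simp add: comp_def)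
  ultimately have "space N' \<in> {space N | N. standard_borel N \<and>
       (\<exists>c. c \<in> M \<rightarrow>\<^sub>M N \<and> distinguishing_coloring (space M) G c)}"
    using N'(1) by blast
  from min_card_le[OF this] have "borel_distinguishing_number M G \<le>o |space N'|"
    unfolding borel_distinguishing_number_def .
  also have "|space N'| \<le>o |space N|"
    unfolding N'(2) by (rule card_of_image)
  finally show ?thesis .
qed

lemma borel_distinguishing_number_attained:
  assumes "standard_borel M"
  shows "\<exists>N c. borel_distinguishing_number M G = |space N| \<and> standard_borel N \<and>
    c \<in> M \<rightarrow>\<^sub>M N \<and> distinguishing_coloring (space M) G c"
proof -
  obtain f and N :: "real measure" where
    N: "standard_borel N" "inj_on f (space M)" "f \<in> M \<rightarrow>\<^sub>M N"
    using standard_borel_real_copy[OF assms] by metis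
  then have "space N \<in> {space N | N. standard_borel N \<and>
       (\<exists>c. c \<in> M \<rightarrow>\<^sub>M N \<and> distinguishing_coloring (space M) G c)}"
    using distinguishing_coloring_inj[OF N(2)] by blast
  from min_card_attained[OF this] show ?thesis
    unfolding borel_distinguishing_number_def by blast
qed

end

theory Submission
  imports Defs
begin

text \<open>The graph is a disjoint union of complete graphs, one on each class of \<open>E\<close>, so its automorphisms
are the permutations of the vertices that preserve \<open>E\<close>. Transposing two points of a class is an
automorphism, and so is exchanging two classes along a bijection. Hence a coloring is distinguishing
iff it is injective on every class and gives different classes different sets of colors
(\<open>distinguishing_inj_on_class\<close>, \<open>distinguishing_inj_on_color_sets\<close>, \<open>distinguishing_coloringI\<close>).

The number \<open>D\<close> is now a matter of counting. An infinite class needs infinitely many colors. Conversely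
there are at most continuum many classes, so they can be given different infinite sets of natural
numbers as their sets of colors (\<open>exists_distinguishing_nat_coloring\<close>).

For the Borel number, suppose that a Borel distinguishing coloring \<open>c\<close> has only countably many colors.
The map that sends \<open>x\<close> to the set of colors on its class then has exactly the \<open>E\<close>-classes as fibers,
so \<open>E\<close> is smooth as soon as this map is Borel, that is, as soon as for each color \<open>i\<close> the saturation
of \<open>{t. c t = i}\<close> is Borel. This saturation is the first projection of the Borel set of all
\<open>(x, t) \<in> E\<close> with \<open>c t = i\<close>. Since \<open>c\<close> is injective on classes, every \<open>x\<close> has at most one such \<open>t\<close>,
and a Borel set with at most one point in each section has a Borel projection
(\<open>injective_projection_measurable\<close>). So \<open>E\<close> being nonsmooth, a Borel distinguishing coloring needs an
uncountable standard Borel space of colors, and such a space contains a nonempty perfect set and has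
the cardinality of the continuum (\<open>uncountable_imp_continuum\<close>).

The theorem on projections is the main work. Let \<open>B \<subseteq> X \<times> Y\<close> be Borel with at most one point in each
section. If \<open>v\<close> is a Borel real function on \<open>Y\<close>, then the points \<open>(x, t)\<close> of \<open>B\<close> with \<open>v t < q\<close> and those
with \<open>v t \<ge> q\<close> have disjoint analytic projections, so Lusin's separation theorem provides a Borel set
of points \<open>x\<close> between them. Letting \<open>q\<close> run through the rationals turns \<open>v\<close> into a Borel function \<open>h\<close>
of \<open>x\<close> with \<open>h x = v t\<close> on \<open>B\<close> (\<open>extend_along_graph\<close>). With the distances to the points of a dense
sequence in the role of \<open>v\<close>, the point \<open>t\<close> can be recovered from the resulting numbers. Thus \<open>B\<close> lies on
the graph of a Borel function \<open>g\<close> with a Borel domain, and the projection of \<open>B\<close> is the Borel set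
where \<open>(x, g x) \<in> B\<close>.\<close>

section \<open>Basic open sets of the Baire space\<close>

definition cylinder :: "nat \<Rightarrow> (nat \<Rightarrow> nat) \<Rightarrow> (nat \<Rightarrow> nat) set" where
  "cylinder n \<alpha> = {\<gamma>. \<forall>i<n. \<gamma> i = \<alpha> i}"

lemma cylinder_self: "\<alpha> \<in> cylinder n \<alpha>"
  by (simp add: cylinder_def)

lemma cylinder_antimono: "m \<le> n \<Longrightarrow> cylinder n \<alpha> \<subseteq> cylinder m \<alpha>"
  by (auto simp: cylinder_def)

lemma open_coordinate: "open {\<beta> :: nat \<Rightarrow> nat. P (\<beta> i)}"
proof -
  have "open ((\<lambda>\<beta> :: nat \<Rightarrow> nat. \<beta> i) -` Collect P)"
    by (intro open_vimage open_discrete) simp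
  then show ?thesis
    by (simp add: vimage_def)
qed

lemma closed_coordinate: "closed {\<beta> :: nat \<Rightarrow> nat. P (\<beta> i)}"
  using open_coordinate[of "\<lambda>a. \<not> P a" i] by (simp add: closed_def Collect_neg_eq[symmetric])

lemma continuous_on_reindex: "continuous_on S (\<lambda>\<alpha> :: nat \<Rightarrow> nat. \<lambda>k. \<alpha> (r k))"
  by (intro continuous_on_coordinatewise_then_product)
    (auto intro: continuous_on_subset[OF continuous_on_product_coordinates])

lemma closed_reindex:
  fixes C :: "(nat \<Rightarrow> nat) set"
  assumes "closed C"
  shows "closed {\<alpha> :: nat \<Rightarrow> nat. (\<lambda>k. \<alpha> (r k)) \<in> C}"
  using closed_vimage[OF assms continuous_on_reindex[of UNIV r]] by (simp add: vimage_def)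

lemma open_contains_cylinder:
  assumes "open W" "\<alpha> \<in> W"
  shows "\<exists>n. cylinder n \<alpha> \<subseteq> W"
proof -
  have "openin (product_topology (\<lambda>i. euclidean) UNIV) W"
    using assms(1) by (simp add: open_fun_def)
  then obtain U :: "nat \<Rightarrow> nat set" where U: "finite {i. U i \<noteq> UNIV}" "\<alpha> \<in> Pi\<^sub>E UNIV U" "Pi\<^sub>E UNIV U \<subseteq> W"
    using assms(2) by (auto simp: openin_product_topology_alt)
  obtain n where n: "\<And>i. U i \<noteq> UNIV \<Longrightarrow> i < n"
    using U(1) finite_nat_set_iff_bounded by auto
  have "cylinder n \<alpha> \<subseteq> Pi\<^sub>E UNIV U"
  proof
    fix \<beta> assume "\<beta> \<in> cylinder n \<alpha>"
    then have "\<beta> i \<in> U i" for i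
      using n[of i] U(2) by (cases "i < n") (auto simp: cylinder_def PiE_iff)
    then show "\<beta> \<in> Pi\<^sub>E UNIV U"
      by auto
  qed
  then show ?thesis
    using U(3) by blast
qed

lemma continuous_on_contains_cylinder:
  fixes u :: "(nat \<Rightarrow> nat) \<Rightarrow> real"
  assumes "continuous_on C u" "\<alpha> \<in> C" "e > 0"
  shows "\<exists>n. \<forall>\<beta> \<in> C \<inter> cylinder n \<alpha>. \<bar>u \<beta> - u \<alpha>\<bar> < e"
proof -
  have "open (ball (u \<alpha>) e)" "u \<alpha> \<in> ball (u \<alpha>) e"
    using assms(3) by auto
  then obtain W where W: "open W" "\<alpha> \<in> W" "\<forall>\<beta>\<in>C. \<beta> \<in> W \<longrightarrow> u \<beta> \<in> ball (u \<alpha>) e"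
    using assms(1,2) unfolding continuous_on_topological by meson
  obtain n where "cylinder n \<alpha> \<subseteq> W"
    using open_contains_cylinder[OF W(1,2)] by blast
  then show ?thesis
    using W(3) by (intro exI[of _ n]) (auto simp: dist_real_def abs_minus_commute)
qed

lemma continuous_on_cylinderI:
  fixes u :: "(nat \<Rightarrow> nat) \<Rightarrow> real"
  assumes "\<And>\<alpha> e. \<alpha> \<in> C \<Longrightarrow> e > 0 \<Longrightarrow> \<exists>n. \<forall>\<beta> \<in> C \<inter> cylinder n \<alpha>. \<bar>u \<beta> - u \<alpha>\<bar> < e"
  shows "continuous_on C u"
  unfolding continuous_on_topological
proof (intro ballI allI impI)
  fix \<alpha> B assume *: "\<alpha> \<in> C" "open B" "u \<alpha> \<in> B"
  then obtain e where e: "e > 0" "ball (u \<alpha>) e \<subseteq> B"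
    using open_contains_ball by blast
  obtain n where n: "\<forall>\<beta> \<in> C \<inter> cylinder n \<alpha>. \<bar>u \<beta> - u \<alpha>\<bar> < e"
    using assms[OF *(1) e(1)] by blast
  have "cylinder n \<alpha> = (\<Inter>i<n. {\<beta>. \<beta> i = \<alpha> i})"
    by (auto simp: cylinder_def)
  then have "open (cylinder n \<alpha>)"
    by (auto intro!: open_INT open_coordinate)
  moreover have "\<forall>\<beta>\<in>C. \<beta> \<in> cylinder n \<alpha> \<longrightarrow> u \<beta> \<in> B"
    using n e(2) by (force simp: dist_real_def abs_minus_commute subset_iff)
  ultimately show "\<exists>A. open A \<and> \<alpha> \<in> A \<and> (\<forall>\<beta>\<in>C. \<beta> \<in> A \<longrightarrow> u \<beta> \<in> B)"
    using cylinder_self by blast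
qed

section \<open>Analytic sets\<close>

text \<open>The ambient space is meant to carry the coarsest topology that makes all functions in \<open>U\<close> continuous.
Naming the topology through real functions lets products be handled by composing with \<open>fst\<close> and \<open>snd\<close>.
The members of \<open>C\<close> are called codes of their images below.\<close>

definition analytic :: "('a \<Rightarrow> real) set \<Rightarrow> 'a set \<Rightarrow> bool" where
  "analytic U A \<longleftrightarrow>
     (\<exists>(C :: (nat \<Rightarrow> nat) set) f. closed C \<and> f ` C = A \<and> (\<forall>u\<in>U. continuous_on C (\<lambda>\<alpha>. u (f \<alpha>))))"

lemma analyticI:
  fixes C :: "(nat \<Rightarrow> nat) set"
  assumes "closed C" "f ` C = A" "\<And>u. u \<in> U \<Longrightarrow> continuous_on C (\<lambda>\<alpha>. u (f \<alpha>))"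
  shows "analytic U A"
  using assms unfolding analytic_def by blast

lemma analyticE:
  assumes "analytic U A"
  obtains C :: "(nat \<Rightarrow> nat) set" and f where
    "closed C" "f ` C = A" "\<And>u. u \<in> U \<Longrightarrow> continuous_on C (\<lambda>\<alpha>. u (f \<alpha>))"
  using assms unfolding analytic_def by auto

lemma analytic_empty: "analytic U {}"
  by (rule analyticI[of "{}"]) auto

lemma analytic_image:
  assumes "analytic U A" "\<And>v. v \<in> V \<Longrightarrow> (\<lambda>x. v (g x)) \<in> U"
  shows "analytic V (g ` A)"
proof -
  obtain C :: "(nat \<Rightarrow> nat) set" and f where C: "closed C" "f ` C = A" "\<And>u. u \<in> U \<Longrightarrow> continuous_on C (\<lambda>\<alpha>. u (f \<alpha>))"
    using assms(1) by (rule analyticE) blast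
  have "(\<lambda>\<alpha>. g (f \<alpha>)) ` C = g ` A"
    using C(2) by auto
  moreover have "continuous_on C (\<lambda>\<alpha>. v (g (f \<alpha>)))" if "v \<in> V" for v
    using C(3)[OF assms(2)[OF that]] .
  ultimately show ?thesis
    using C(1) analyticI[of C "\<lambda>\<alpha>. g (f \<alpha>)"] by blast
qed

lemma analytic_restrict:
  assumes "analytic U A" "u \<in> U" "closed T"
  shows "analytic U {x \<in> A. u x \<in> T}"
proof -
  obtain C :: "(nat \<Rightarrow> nat) set" and f where C: "closed C" "f ` C = A" "\<And>u. u \<in> U \<Longrightarrow> continuous_on C (\<lambda>\<alpha>. u (f \<alpha>))"
    using assms(1) by (rule analyticE) blast
  show ?thesis
  proof (rule analyticI)
    show "closed (C \<inter> (\<lambda>\<alpha>. u (f \<alpha>)) -` T)"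
      using continuous_closed_preimage[OF C(3)[OF assms(2)] C(1) assms(3)] .
    show "f ` (C \<inter> (\<lambda>\<alpha>. u (f \<alpha>)) -` T) = {x \<in> A. u x \<in> T}"
      using C(2) by auto
    show "continuous_on (C \<inter> (\<lambda>\<alpha>. u (f \<alpha>)) -` T) (\<lambda>\<alpha>. v (f \<alpha>))" if "v \<in> U" for v
      using C(3)[OF that] by (rule continuous_on_subset) auto
  qed
qed

text \<open>The first entry of a code selects a set of the family, the remaining entries are a code for the point
in that set.\<close>

lemma analytic_Union:
  fixes A :: "nat \<Rightarrow> 'a set"
  assumes "\<And>n. analytic U (A n)"
  shows "analytic U (\<Union>n. A n)"
proof -
  have "\<exists>C f. closed C \<and> f ` C = A n \<and> (\<forall>u\<in>U. continuous_on C (\<lambda>\<alpha> :: nat \<Rightarrow> nat. u (f \<alpha>)))" for n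
    using assms[of n] unfolding analytic_def .
  then obtain C :: "nat \<Rightarrow> (nat \<Rightarrow> nat) set" and f where
    C: "\<And>n. closed (C n)" "\<And>n. f n ` C n = A n"
      "\<And>n u. u \<in> U \<Longrightarrow> continuous_on (C n) (\<lambda>\<alpha>. u (f n \<alpha>))"
    by metis
  define tail where "tail \<alpha> = (\<lambda>k. \<alpha> (Suc k))" for \<alpha> :: "nat \<Rightarrow> nat"
  define C' where "C' = {\<alpha>. tail \<alpha> \<in> C (\<alpha> 0)}"
  have tail_case: "tail (case_nat n \<beta>) = \<beta>" for n \<beta>
    by (simp add: tail_def)
  show ?thesis
  proof (rule analyticI)
    have "C' = (\<Inter>n. {\<alpha>. \<alpha> 0 \<noteq> n} \<union> {\<alpha>. tail \<alpha> \<in> C n})"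
      by (auto simp: C'_def)
    then show "closed C'"
      unfolding tail_def by (auto intro!: closed_INT closed_Un closed_reindex C(1) closed_coordinate)
    show "(\<lambda>\<alpha>. f (\<alpha> 0) (tail \<alpha>)) ` C' = (\<Union>n. A n)"
    proof (intro equalityI subsetI)
      fix x assume "x \<in> (\<Union>n. A n)"
      then obtain n \<beta> where n: "\<beta> \<in> C n" "x = f n \<beta>"
        using C(2) by fast
      then show "x \<in> (\<lambda>\<alpha>. f (\<alpha> 0) (tail \<alpha>)) ` C'"
        by (intro image_eqI[of _ _ "case_nat n \<beta>"]) (simp_all add: C'_def tail_case)
    qed (use C(2) in \<open>auto simp: C'_def\<close>)
    fix u assume u: "u \<in> U"
    show "continuous_on C' (\<lambda>\<alpha>. u (f (\<alpha> 0) (tail \<alpha>)))"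
    proof (rule continuous_on_cylinderI)
      fix \<alpha> and e :: real assume a: "\<alpha> \<in> C'" "e > 0"
      have "\<exists>n. \<forall>\<beta> \<in> C (\<alpha> 0) \<inter> cylinder n (tail \<alpha>). \<bar>u (f (\<alpha> 0) \<beta>) - u (f (\<alpha> 0) (tail \<alpha>))\<bar> < e"
        using a by (intro continuous_on_contains_cylinder C(3) u) (auto simp: C'_def)
      then obtain n where n: "\<forall>\<beta> \<in> C (\<alpha> 0) \<inter> cylinder n (tail \<alpha>).
          \<bar>u (f (\<alpha> 0) \<beta>) - u (f (\<alpha> 0) (tail \<alpha>))\<bar> < e" ..
      have "\<beta> 0 = \<alpha> 0 \<and> tail \<beta> \<in> cylinder n (tail \<alpha>)" if "\<beta> \<in> cylinder (Suc n) \<alpha>" for \<beta>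
        using that by (auto simp: cylinder_def tail_def)
      then show "\<exists>n. \<forall>\<beta>\<in>C' \<inter> cylinder n \<alpha>.
          \<bar>u (f (\<beta> 0) (tail \<beta>)) - u (f (\<alpha> 0) (tail \<alpha>))\<bar> < e"
        using n by (intro exI[of _ "Suc n"]) (auto simp: C'_def)
    qed
  qed
qed

text \<open>A code is a matrix whose \<open>n\<close>-th row is a code in the \<open>n\<close>-th parameter set, all rows describing the same
point. Because \<open>U\<close> separates points, this agreement is a closed condition.\<close>

lemma analytic_Inter:
  fixes A :: "nat \<Rightarrow> 'a set"
  assumes "\<And>n. analytic U (A n)" "\<And>n. A n \<subseteq> S"
    and sep: "\<And>x y. x \<in> S \<Longrightarrow> y \<in> S \<Longrightarrow> \<forall>u\<in>U. u x = u y \<Longrightarrow> x = y"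
  shows "analytic U (\<Inter>n. A n)"
proof -
  have "\<exists>C f. closed C \<and> f ` C = A n \<and> (\<forall>u\<in>U. continuous_on C (\<lambda>\<alpha> :: nat \<Rightarrow> nat. u (f \<alpha>)))" for n
    using assms(1)[of n] unfolding analytic_def .
  then obtain C :: "nat \<Rightarrow> (nat \<Rightarrow> nat) set" and f where
    C: "\<And>n. closed (C n)" "\<And>n. f n ` C n = A n"
      "\<And>n u. u \<in> U \<Longrightarrow> continuous_on (C n) (\<lambda>\<alpha>. u (f n \<alpha>))"
    by metis
  define row where "row n \<alpha> = (\<lambda>k. \<alpha> (prod_encode (n, k)))" for n and \<alpha> :: "nat \<Rightarrow> nat"
  define D where "D = (\<Inter>n. {\<alpha>. row n \<alpha> \<in> C n})"
  define C' where "C' = {\<alpha> \<in> D. \<forall>n. f n (row n \<alpha>) = f 0 (row 0 \<alpha>)}"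
  have clD: "closed D"
    unfolding D_def row_def by (auto intro!: closed_INT closed_reindex C(1))
  have cont: "continuous_on D (\<lambda>\<alpha>. u (f n (row n \<alpha>)))" if "u \<in> U" for u n
  proof (rule continuous_on_compose2[OF C(3)[OF that, of n]])
    show "continuous_on D (row n)"
      unfolding row_def by (rule continuous_on_reindex)
  qed (auto simp: D_def)
  have inS: "f n (row n \<alpha>) \<in> S" if "\<alpha> \<in> D" for n \<alpha>
    using that C(2)[of n] assms(2)[of n] by (auto simp: D_def)
  have "f n (row n \<alpha>) = f 0 (row 0 \<alpha>) \<longleftrightarrow> (\<forall>u\<in>U. u (f n (row n \<alpha>)) = u (f 0 (row 0 \<alpha>)))"
    if "\<alpha> \<in> D" for n \<alpha>
    using sep[OF inS[OF that] inS[OF that], of n 0] by fastforce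
  then have "C' = {\<alpha> \<in> D. \<forall>n. \<forall>u\<in>U. u (f n (row n \<alpha>)) = u (f 0 (row 0 \<alpha>))}"
    unfolding C'_def by (intro Collect_cong conj_cong refl all_cong1)
  then have C'_eq: "C' = D \<inter> (\<Inter>n. \<Inter>u\<in>U. {\<alpha> \<in> D. u (f n (row n \<alpha>)) - u (f 0 (row 0 \<alpha>)) = 0})"
    by auto
  show ?thesis
  proof (rule analyticI[of C' "\<lambda>\<alpha>. f 0 (row 0 \<alpha>)"])
    have cl: "closed {\<alpha> \<in> D. u (f n (row n \<alpha>)) - u (f 0 (row 0 \<alpha>)) = 0}" if "u \<in> U" for n u
      using clD by (intro continuous_closed_preimage_constant continuous_on_diff cont that)
    then have "closed (\<Inter>n. \<Inter>u\<in>U. {\<alpha> \<in> D. u (f n (row n \<alpha>)) - u (f 0 (row 0 \<alpha>)) = 0})"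
      using cl by (simp del: right_minus_eq add: closed_INT)
    then show "closed C'"
      unfolding C'_eq by (rule closed_Int[OF clD])
    show "(\<lambda>\<alpha>. f 0 (row 0 \<alpha>)) ` C' = (\<Inter>n. A n)"
    proof (intro equalityI subsetI)
      fix x assume "x \<in> (\<Inter>n. A n)"
      then have img: "x \<in> f n ` C n" for n
        using C(2)[of n] by auto
      have "\<exists>\<beta>\<in>C n. f n \<beta> = x" for n
        using img[of n] by auto
      then obtain \<beta> where \<beta>: "\<And>n. \<beta> n \<in> C n" "\<And>n. f n (\<beta> n) = x"
        by metis
      define \<alpha> where "\<alpha> k = (case prod_decode k of (n, j) \<Rightarrow> \<beta> n j)" for k
      have "row n \<alpha> = \<beta> n" for n
        by (simp add: row_def \<alpha>_def)
      then show "x \<in> (\<lambda>\<alpha>. f 0 (row 0 \<alpha>)) ` C'"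
        using \<beta> by (auto simp: C'_def D_def intro!: image_eqI[of _ _ \<alpha>])
    next
      fix x assume "x \<in> (\<lambda>\<alpha>. f 0 (row 0 \<alpha>)) ` C'"
      then obtain \<alpha> where \<alpha>: "\<alpha> \<in> D" "\<forall>n. f n (row n \<alpha>) = x"
        by (auto simp: C'_def)
      have "f n (row n \<alpha>) \<in> A n" for n
        using C(2)[of n] \<alpha>(1) by (auto simp: D_def)
      then show "x \<in> (\<Inter>n. A n)"
        using \<alpha>(2) by simp
    qed
    show "continuous_on C' (\<lambda>\<alpha>. u (f 0 (row 0 \<alpha>)))" if "u \<in> U" for u
      using cont[OF that] by (rule continuous_on_subset) (auto simp: C'_def)
  qed
qed

lemma analytic_Times:
  assumes "analytic U A" "analytic V B"
  shows "analytic ((\<lambda>u z. u (fst z)) ` U \<union> (\<lambda>v z. v (snd z)) ` V) (A \<times> B)"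
proof -
  obtain C :: "(nat \<Rightarrow> nat) set" and f where C: "closed C" "f ` C = A" "\<And>u. u \<in> U \<Longrightarrow> continuous_on C (\<lambda>\<alpha>. u (f \<alpha>))"
    using assms(1) by (rule analyticE) blast
  obtain D :: "(nat \<Rightarrow> nat) set" and g where D: "closed D" "g ` D = B" "\<And>v. v \<in> V \<Longrightarrow> continuous_on D (\<lambda>\<alpha>. v (g \<alpha>))"
    using assms(2) by (rule analyticE) blast
  define evens where "evens \<alpha> = (\<lambda>k. \<alpha> (2 * k))" for \<alpha> :: "nat \<Rightarrow> nat"
  define odds where "odds \<alpha> = (\<lambda>k. \<alpha> (Suc (2 * k)))" for \<alpha> :: "nat \<Rightarrow> nat"
  define P where "P = {\<alpha>. evens \<alpha> \<in> C} \<inter> {\<alpha>. odds \<alpha> \<in> D}"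
  show ?thesis
  proof (rule analyticI[of P "\<lambda>\<alpha>. (f (evens \<alpha>), g (odds \<alpha>))"])
    show "closed P"
      unfolding P_def evens_def odds_def by (intro closed_Int closed_reindex C(1) D(1))
    show "(\<lambda>\<alpha>. (f (evens \<alpha>), g (odds \<alpha>))) ` P = A \<times> B"
    proof (intro equalityI subsetI)
      fix z assume "z \<in> A \<times> B"
      then obtain \<beta> \<gamma> where z: "\<beta> \<in> C" "\<gamma> \<in> D" "z = (f \<beta>, g \<gamma>)"
        using C(2) D(2) by fast
      define \<alpha> where "\<alpha> k = (if even k then \<beta> (k div 2) else \<gamma> (k div 2))" for k
      have "evens \<alpha> = \<beta>" "odds \<alpha> = \<gamma>"
        by (auto simp: evens_def odds_def \<alpha>_def)
      then show "z \<in> (\<lambda>\<alpha>. (f (evens \<alpha>), g (odds \<alpha>))) ` P"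
        using z by (auto simp: P_def intro!: image_eqI[of _ _ \<alpha>])
    qed (use C(2) D(2) in \<open>auto simp: P_def\<close>)
    fix w assume "w \<in> (\<lambda>u z. u (fst z)) ` U \<union> (\<lambda>v z. v (snd z)) ` V"
    then consider u where "u \<in> U" "w = (\<lambda>z. u (fst z))" | v where "v \<in> V" "w = (\<lambda>z. v (snd z))"
      by blast
    then show "continuous_on P (\<lambda>\<alpha>. w (f (evens \<alpha>), g (odds \<alpha>)))"
    proof cases
      case 1
      have "continuous_on P evens"
        unfolding evens_def by (rule continuous_on_reindex)
      then show ?thesis
        unfolding 1(2) fst_conv
        by (rule continuous_on_compose2[OF C(3)[OF 1(1)]]) (auto simp: P_def)
    next
      case 2
      have "continuous_on P odds"
        unfolding odds_def by (rule continuous_on_reindex)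
      then show ?thesis
        unfolding 2(2) snd_conv
        by (rule continuous_on_compose2[OF D(3)[OF 2(1)]]) (auto simp: P_def)
    qed
  qed
qed

text \<open>Analyticity can be lost under complements, hence the passage to sets that are analytic together with their
complements. Once this \<open>\<sigma>\<close>-algebra contains generators of the Borel sets, all Borel sets are analytic.\<close>

lemma bianalytic_sigma_algebra:
  assumes S: "analytic U S"
    and sep: "\<And>x y. x \<in> S \<Longrightarrow> y \<in> S \<Longrightarrow> \<forall>u\<in>U. u x = u y \<Longrightarrow> x = y"
  shows "sigma_algebra S {A. A \<subseteq> S \<and> analytic U A \<and> analytic U (S - A)}" (is "sigma_algebra S ?\<B>")
proof -
  have "?\<B> \<subseteq> Pow S"
    by (rule subsetI) simp
  moreover have "{} \<in> ?\<B>"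
    using S by (simp add: analytic_empty)
  moreover have "S - A \<in> ?\<B>" if "A \<in> ?\<B>" for A
    using that by (simp add: double_diff)
  moreover have "(\<Union>n. A n) \<in> ?\<B>" if "range A \<subseteq> ?\<B>" for A :: "nat \<Rightarrow> 'a set"
  proof -
    have A: "A n \<subseteq> S" "analytic U (A n)" "analytic U (S - A n)" for n
      using that by auto
    have "analytic U (\<Inter>n. S - A n)"
      by (rule analytic_Inter[OF A(3) _ sep]) simp_all
    then have "analytic U (S - (\<Union>n. A n))"
      by simp
    moreover have "(\<Union>n. A n) \<subseteq> S"
      using A(1) by (rule UN_least)
    ultimately show ?thesis
      using analytic_Union[of U A, OF A(2)] by simp
  qed
  ultimately show ?thesis
    unfolding sigma_algebra_iff2 by simp
qed

lemma bianalytic_less: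
  assumes S: "analytic U S" and u: "u \<in> U"
  shows "analytic U {x \<in> S. u x < q}" "analytic U {x \<in> S. \<not> u x < q}"
proof -
  have "{x \<in> S. u x < q} = (\<Union>n. {x \<in> S. u x \<in> {..q - inverse (real (Suc n))}})"
  proof (intro equalityI subsetI)
    fix x assume x: "x \<in> {x \<in> S. u x < q}"
    then have "0 < q - u x"
      by simp
    then obtain n where "inverse (real (Suc n)) < q - u x"
      using reals_Archimedean by blast
    then show "x \<in> (\<Union>n. {x \<in> S. u x \<in> {..q - inverse (real (Suc n))}})"
      using x by (auto intro!: exI[of _ n])
  next
    fix x assume "x \<in> (\<Union>n. {x \<in> S. u x \<in> {..q - inverse (real (Suc n))}})"
    then obtain n where "x \<in> S" "u x \<le> q - inverse (real (Suc n))"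
      by auto
    moreover have "0 < inverse (real (Suc n))"
      by simp
    ultimately show "x \<in> {x \<in> S. u x < q}"
      by (metis (mono_tags, lifting) diff_less_eq less_add_same_cancel1 mem_Collect_eq order_le_less_trans)
  qed
  then show "analytic U {x \<in> S. u x < q}"
    using analytic_Union[OF analytic_restrict[OF S u closed_atMost]] by simp
  show "analytic U {x \<in> S. \<not> u x < q}"
    using analytic_restrict[OF S u closed_atLeast[of q]] by (simp add: not_less)
qed

section \<open>Lusin separation\<close>

definition separated_by :: "'a set set \<Rightarrow> 'a set \<Rightarrow> 'a set \<Rightarrow> bool" where
  "separated_by \<M> P Q \<longleftrightarrow> (\<exists>S\<in>\<M>. P \<subseteq> S \<and> S \<inter> Q = {})"

text \<open>In the contrapositive: if two countable unions cannot be separated, then some piece of one cannot be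
separated from some piece of the other. This drives the construction of branches in Lusin's theorem.\<close>

lemma separated_by_UN:
  fixes P Q :: "nat \<Rightarrow> 'a set"
  assumes "\<And>a b. separated_by (sets M) (P a) (Q b)"
  shows "separated_by (sets M) (\<Union>a. P a) (\<Union>b. Q b)"
proof -
  obtain S where S: "\<And>a b. S a b \<in> sets M" "\<And>a b. P a \<subseteq> S a b" "\<And>a b. S a b \<inter> Q b = {}"
    using assms unfolding separated_by_def by metis
  have "(\<Union>a. \<Inter>b. S a b) \<in> sets M"
    using S(1) by blast
  moreover have "(\<Union>a. P a) \<subseteq> (\<Union>a. \<Inter>b. S a b)"
    using S(2) by (intro UN_mono INT_greatest) auto
  moreover have "(\<Union>a. \<Inter>b. S a b) \<inter> (\<Union>b. Q b) = {}"
  proof -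
    have "x \<notin> Q b" if "x \<in> (\<Inter>b. S a b)" for x a b
      using that S(3)[of a b] by auto
    then show ?thesis
      by auto
  qed
  ultimately show ?thesis
    unfolding separated_by_def by blast
qed

text \<open>If the sets cannot be separated, then restricting the codes to ever longer initial segments keeps two
inseparable pieces and leads to a pair of infinite branches \<open>\<alpha>\<close>, \<open>\<beta>\<close>. Their images are different
points, so some \<open>u \<in> U\<close> takes different values there, and by continuity a condition on \<open>u\<close> alone
separates the images of two sufficiently small cylinders around \<open>\<alpha>\<close> and \<open>\<beta>\<close>, a contradiction.\<close>

lemma lusin_separation:
  assumes "analytic U A" "analytic U B" "A \<inter> B = {}" "A \<subseteq> space M" "B \<subseteq> space M"
    and meas: "\<And>u. u \<in> U \<Longrightarrow> u \<in> borel_measurable M"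
    and sep: "\<And>x y. x \<in> space M \<Longrightarrow> y \<in> space M \<Longrightarrow> \<forall>u\<in>U. u x = u y \<Longrightarrow> x = y"
  shows "\<exists>S\<in>sets M. A \<subseteq> S \<and> S \<inter> B = {}"
proof (rule ccontr)
  assume "\<not> ?thesis"
  then have neg: "\<not> separated_by (sets M) A B"
    by (simp add: separated_by_def)
  obtain C :: "(nat \<Rightarrow> nat) set" and f where C: "closed C" "f ` C = A" "\<And>u. u \<in> U \<Longrightarrow> continuous_on C (\<lambda>\<alpha>. u (f \<alpha>))"
    using assms(1) by (rule analyticE) blast
  obtain D :: "(nat \<Rightarrow> nat) set" and g where D: "closed D" "g ` D = B" "\<And>u. u \<in> U \<Longrightarrow> continuous_on D (\<lambda>\<alpha>. u (g \<alpha>))"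
    using assms(2) by (rule analyticE) blast
  define bad where "bad n \<alpha> \<beta> \<longleftrightarrow>
    \<not> separated_by (sets M) (f ` (C \<inter> cylinder n \<alpha>)) (g ` (D \<inter> cylinder n \<beta>))" for n \<alpha> \<beta>
  have split: "cylinder n \<alpha> = (\<Union>a. cylinder (Suc n) (\<alpha>(n := a)))" for n \<alpha>
    by (auto simp: cylinder_def less_Suc_eq)
  \<comment> \<open>Cutting each cylinder according to the value at \<open>n\<close> leaves a bad pair.\<close>
  have step: "\<exists>a b. bad (Suc n) (\<alpha>(n := a)) (\<beta>(n := b))" if "bad n \<alpha> \<beta>" for n \<alpha> \<beta>
  proof (rule ccontr)
    assume "\<not> ?thesis"
    then have "separated_by (sets M) (\<Union>a. f ` (C \<inter> cylinder (Suc n) (\<alpha>(n := a))))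
        (\<Union>b. g ` (D \<inter> cylinder (Suc n) (\<beta>(n := b))))"
      by (intro separated_by_UN) (auto simp: bad_def)
    moreover have "(\<Union>a. f ` (C \<inter> cylinder (Suc n) (\<alpha>(n := a)))) = f ` (C \<inter> cylinder n \<alpha>)"
      "(\<Union>b. g ` (D \<inter> cylinder (Suc n) (\<beta>(n := b)))) = g ` (D \<inter> cylinder n \<beta>)"
      by (subst split; fast)+
    ultimately show False
      using that by (simp add: bad_def)
  qed
  have "bad 0 \<alpha> \<beta>" for \<alpha> \<beta>
    using neg C(2) D(2) by (simp add: bad_def cylinder_def)
  then have "\<exists>p. \<forall>n. bad n (fst (p n)) (snd (p n)) \<and>
      (\<exists>a b. p (Suc n) = ((fst (p n))(n := a), (snd (p n))(n := b)))"
    by (intro dependent_nat_choice) (use step in \<open>force+\<close>)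
  then obtain p where p: "\<And>n. bad n (fst (p n)) (snd (p n))"
    "\<And>n. \<exists>a b. p (Suc n) = ((fst (p n))(n := a), (snd (p n))(n := b))"
    by blast
  define \<alpha> where "\<alpha> i = fst (p (Suc i)) i" for i
  define \<beta> where "\<beta> i = snd (p (Suc i)) i" for i
  have stable: "fst (p n) i = \<alpha> i \<and> snd (p n) i = \<beta> i" if "i < n" for i n
    using that
  proof (induction n)
    case (Suc n)
    show ?case
    proof (cases "i = n")
      case False
      then show ?thesis
        using Suc p(2)[of n] by auto
    qed (simp add: \<alpha>_def \<beta>_def)
  qed simp
  have bad: "bad n \<alpha> \<beta>" for n
  proof -
    have "cylinder n (fst (p n)) = cylinder n \<alpha>" "cylinder n (snd (p n)) = cylinder n \<beta>"
      using stable by (auto simp: cylinder_def)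
    then show ?thesis
      using p(1)[of n] by (simp add: bad_def)
  qed
  \<comment> \<open>An empty piece is separated from anything, and \<open>C\<close>, \<open>D\<close> are closed, so the branches lie in them.\<close>
  have nonempty: "C \<inter> cylinder n \<alpha> \<noteq> {}" "D \<inter> cylinder n \<beta> \<noteq> {}" for n
  proof -
    have "{} \<in> sets M" "space M \<in> sets M" "f ` (C \<inter> cylinder n \<alpha>) \<subseteq> space M"
      using C(2) assms(4) by auto
    then show "C \<inter> cylinder n \<alpha> \<noteq> {}" "D \<inter> cylinder n \<beta> \<noteq> {}"
      using bad[of n] by (auto simp: bad_def separated_by_def)
  qed
  have "\<alpha> \<in> C"
    using C(1) nonempty(1) open_contains_cylinder[of "- C" \<alpha>] by fast
  have "\<beta> \<in> D"
    using D(1) nonempty(2) open_contains_cylinder[of "- D" \<beta>] by fast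
  have "f \<alpha> \<in> A" "g \<beta> \<in> B"
    using C(2) D(2) \<open>\<alpha> \<in> C\<close> \<open>\<beta> \<in> D\<close> by auto
  then obtain u where u: "u \<in> U" "u (f \<alpha>) \<noteq> u (g \<beta>)"
  proof -
    have "f \<alpha> \<in> space M" "g \<beta> \<in> space M" "f \<alpha> \<noteq> g \<beta>"
      using assms(3,4,5) \<open>f \<alpha> \<in> A\<close> \<open>g \<beta> \<in> B\<close> by auto
    then have "\<not> (\<forall>u\<in>U. u (f \<alpha>) = u (g \<beta>))"
      using sep by blast
    then show ?thesis
      using that by blast
  qed
  define e where "e = \<bar>u (f \<alpha>) - u (g \<beta>)\<bar> / 2"
  have "e > 0"
    using u(2) by (simp add: e_def)
  obtain m where m: "\<forall>\<gamma> \<in> C \<inter> cylinder m \<alpha>. \<bar>u (f \<gamma>) - u (f \<alpha>)\<bar> < e"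
    using continuous_on_contains_cylinder[OF C(3)[OF u(1)] \<open>\<alpha> \<in> C\<close> \<open>e > 0\<close>] by blast
  obtain n where n: "\<forall>\<gamma> \<in> D \<inter> cylinder n \<beta>. \<bar>u (g \<gamma>) - u (g \<beta>)\<bar> < e"
    using continuous_on_contains_cylinder[OF D(3)[OF u(1)] \<open>\<beta> \<in> D\<close> \<open>e > 0\<close>] by blast
  define S where "S = {x \<in> space M. \<bar>u x - u (f \<alpha>)\<bar> < e}"
  have [measurable]: "u \<in> borel_measurable M"
    by (rule meas[OF u(1)])
  have "S \<in> sets M"
    unfolding S_def by measurable
  moreover have "f ` (C \<inter> cylinder (max m n) \<alpha>) \<subseteq> S"
    using m C(2) assms(4) cylinder_antimono[of m "max m n" \<alpha>] by (auto simp: S_def)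
  moreover have "S \<inter> g ` (D \<inter> cylinder (max m n) \<beta>) = {}"
  proof -
    have "x \<notin> S" if "x \<in> g ` (D \<inter> cylinder (max m n) \<beta>)" for x
    proof -
      have "\<bar>u x - u (g \<beta>)\<bar> < e"
        using that n cylinder_antimono[of n "max m n" \<beta>] by auto
      then show ?thesis
        unfolding S_def e_def by (auto simp: abs_if split: if_splits)
    qed
    then show ?thesis
      by blast
  qed
  ultimately have "\<not> bad (max m n) \<alpha> \<beta>"
    by (auto simp: bad_def separated_by_def)
  then show False
    using bad by blast
qed

section \<open>Standard Borel spaces through distances to a dense sequence\<close>

text \<open>A standard Borel space with a chosen complete metric and a dense sequence. The last assumption says
that the balls around the sequence generate the Borel sets, so that only the countably many functions
\<open>d (y k)\<close> have to be dealt with.\<close>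

locale polish_borel = Metric_space "space M" d for M :: "'a measure" and d +
  fixes y :: "nat \<Rightarrow> 'a"
  assumes complete: mcomplete
    and y_in: "y k \<in> space M"
    and dense: "x \<in> space M \<Longrightarrow> e > 0 \<Longrightarrow> \<exists>k. d (y k) x < e"
    and sets_eq: "sets M = sigma_sets (space M) (range (\<lambda>(k, q). {x \<in> space M. d (y k) x < q}))"
begin

definition coords :: "('a \<Rightarrow> real) set" where
  "coords = range (\<lambda>k. d (y k))"

lemma coords_measurable:
  assumes "u \<in> coords"
  shows "u \<in> borel_measurable M"
proof -
  obtain k where "u = d (y k)"
    using assms by (auto simp: coords_def)
  then have "{x \<in> space M. u x < q} \<in> sets M" for q
    unfolding sets_eq by (intro sigma_sets.Basic image_eqI[of _ _ "(k, q)"]) auto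
  then show ?thesis
    by (simp add: borel_measurable_iff_less)
qed

lemma eq_if_small_dist:
  assumes "x \<in> space M" "x' \<in> space M" "\<And>e. e > 0 \<Longrightarrow> d x x' < e"
  shows "x = x'"
  using assms(3)[of "d x x'"] mdist_pos_less[OF _ assms(1,2)] by blast

lemma coords_separate:
  assumes "x \<in> space M" "x' \<in> space M" "\<forall>u\<in>coords. u x = u x'"
  shows "x = x'"
proof (rule eq_if_small_dist[OF assms(1,2)])
  fix e :: real assume "e > 0"
  then obtain k where k: "d (y k) x < e / 2"
    using dense[OF assms(1), of "e / 2"] by auto
  moreover have "d (y k) x' = d (y k) x"
    using assms(3) by (auto simp: coords_def)
  ultimately show "d x x' < e"
    using triangle''[OF assms(1) y_in assms(2), of k] by simp
qed

text \<open>Completeness with an explicit rate of convergence, as needed to make limits depend continuously on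
the sequence.\<close>

lemma Cauchy_limit:
  assumes x: "\<And>n. x n \<in> space M" and r: "r \<longlonglongrightarrow> 0"
    and le: "\<And>n m. d (x n) (x m) \<le> r n + r m"
  shows "\<exists>l\<in>space M. \<forall>n. d (x n) l \<le> r n"
proof -
  have small: "\<exists>N. \<forall>n\<ge>N. r n < e" if "e > 0" for e
    using order_tendstoD(2)[OF r that] by (simp add: eventually_sequentially)
  have "MCauchy x"
    unfolding MCauchy_def
  proof (intro conjI allI impI)
    fix e :: real assume "e > 0"
    then obtain N where N: "\<forall>n\<ge>N. r n < e / 2"
      using small[of "e / 2"] by auto
    have "d (x n) (x n') < e" if "N \<le> n" "N \<le> n'" for n n'
    proof -
      have "r n < e / 2" "r n' < e / 2"
        using N that by auto
      then show ?thesis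
        using le[of n n'] by simp
    qed
    then show "\<exists>N. \<forall>n n'. N \<le> n \<longrightarrow> N \<le> n' \<longrightarrow> d (x n) (x n') < e"
      by blast
  qed (use x in auto)
  then obtain l where l: "limitin mtopology x l sequentially"
    using complete unfolding mcomplete_def by blast
  then have "l \<in> space M"
    by (simp add: limitin_metric)
  moreover have "d (x n) l \<le> r n" for n
  proof (rule field_le_epsilon)
    fix e :: real assume "e > 0"
    then have "\<forall>\<^sub>F m in sequentially. d (x m) l < e / 2"
      using l half_gt_zero[of e] unfolding limitin_metric by (auto elim!: allE[of _ "e / 2"] eventually_mono)
    moreover have "\<forall>\<^sub>F m in sequentially. r m < e / 2"
      by (rule order_tendstoD(2)[OF r half_gt_zero[OF \<open>e > 0\<close>]])
    ultimately have "\<forall>\<^sub>F m in sequentially. d (x m) l < e / 2 \<and> r m < e / 2"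
      by (rule eventually_conj)
    then obtain m where "d (x m) l < e / 2" "r m < e / 2"
      using eventually_happens' sequentially_bot by blast
    then show "d (x n) l \<le> r n + e"
      using triangle[OF x x \<open>l \<in> space M\<close>, of n m] le[of n m] by simp
  qed
  ultimately show ?thesis
    by blast
qed

text \<open>A code \<open>\<alpha>\<close> stands for the limit of the points \<open>y (\<alpha> n)\<close>. Only sequences that converge at a prescribed
rate are admitted: this is a closed condition on \<open>\<alpha>\<close>, and finitely many entries of \<open>\<alpha>\<close> then determine
the limit up to a given error.\<close>

lemma analytic_space: "analytic coords (space M)"
proof -
  define r where "r n = inverse (real (Suc n))" for n
  have r: "r \<longlonglongrightarrow> 0"
    unfolding r_def by (rule LIMSEQ_inverse_real_of_nat)
  have small: "\<exists>n. r n < e" if "e > 0" for e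
    using reals_Archimedean[OF that] by (simp add: r_def)
  have r_pos: "r n > 0" for n
    by (simp add: r_def)
  define C where "C = {\<alpha> :: nat \<Rightarrow> nat. \<forall>n m. d (y (\<alpha> n)) (y (\<alpha> m)) \<le> r n + r m}"
  have "\<exists>l\<in>space M. \<forall>n. d (y (\<alpha> n)) l \<le> r n" if "\<alpha> \<in> C" for \<alpha>
    using that by (intro Cauchy_limit y_in r) (auto simp: C_def)
  then obtain f where f: "\<And>\<alpha>. \<alpha> \<in> C \<Longrightarrow> f \<alpha> \<in> space M" "\<And>\<alpha> n. \<alpha> \<in> C \<Longrightarrow> d (y (\<alpha> n)) (f \<alpha>) \<le> r n"
    by metis
  show ?thesis
  proof (rule analyticI[of C f])
    have "closed {\<alpha> :: nat \<Rightarrow> nat. d (y (\<alpha> n)) (y (\<alpha> m)) \<le> r n + r m}" for n m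
    proof -
      have "{\<alpha> :: nat \<Rightarrow> nat. d (y (\<alpha> n)) (y (\<alpha> m)) \<le> r n + r m} =
          (\<Inter>a. {\<alpha>. \<alpha> n \<noteq> a} \<union> {\<alpha>. d (y a) (y (\<alpha> m)) \<le> r n + r m})"
        by auto
      also have "closed \<dots>"
        by (intro closed_INT ballI closed_Un closed_coordinate)
      finally show ?thesis .
    qed
    moreover have "C = (\<Inter>n. \<Inter>m. {\<alpha>. d (y (\<alpha> n)) (y (\<alpha> m)) \<le> r n + r m})"
      by (auto simp: C_def)
    ultimately show "closed C"
      by (simp add: closed_INT)
    show "f ` C = space M"
    proof (intro equalityI subsetI)
      fix x assume x: "x \<in> space M"
      have "\<exists>k. d (y k) x < r n" for n
        using dense[OF x r_pos] .
      then obtain \<alpha> where \<alpha>: "\<And>n. d (y (\<alpha> n)) x < r n"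
        by metis
      have "d (y (\<alpha> n)) (y (\<alpha> m)) \<le> r n + r m" for n m
        using triangle'[OF y_in x y_in, of "\<alpha> n" "\<alpha> m"] \<alpha>[of n] \<alpha>[of m] by linarith
      then have "\<alpha> \<in> C"
        by (simp add: C_def)
      have "f \<alpha> = x"
      proof (rule eq_if_small_dist[OF f(1)[OF \<open>\<alpha> \<in> C\<close>] x])
        fix e :: real assume "e > 0"
        then obtain n where "r n < e / 2"
          using small[of "e / 2"] by auto
        then show "d (f \<alpha>) x < e"
          using triangle''[OF f(1)[OF \<open>\<alpha> \<in> C\<close>] y_in x, of "\<alpha> n"] \<alpha>[of n] f(2)[OF \<open>\<alpha> \<in> C\<close>, of n]
          by linarith
      qed
      then show "x \<in> f ` C"
        using \<open>\<alpha> \<in> C\<close> by blast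
    qed (use f in auto)
    fix u assume "u \<in> coords"
    then obtain k where u: "u = d (y k)"
      by (auto simp: coords_def)
    show "continuous_on C (\<lambda>\<alpha>. u (f \<alpha>))"
    proof (rule continuous_on_cylinderI)
      fix \<alpha> and e :: real assume \<alpha>: "\<alpha> \<in> C" and "e > 0"
      then obtain n where n: "r n < e / 2"
        using small[of "e / 2"] by auto
      have "\<bar>u (f \<beta>) - u (f \<alpha>)\<bar> < e" if "\<beta> \<in> C \<inter> cylinder (Suc n) \<alpha>" for \<beta>
      proof -
        have \<beta>: "\<beta> \<in> C" "\<beta> n = \<alpha> n"
          using that by (auto simp: cylinder_def)
        have "d (f \<alpha>) (f \<beta>) < e"
          using triangle''[OF f(1)[OF \<alpha>] y_in f(1)[OF \<beta>(1)], of "\<alpha> n"]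
            f(2)[OF \<alpha>, of n] f(2)[OF \<beta>(1), of n] \<beta>(2) n by simp
        then show ?thesis
          using triangle[OF y_in f(1)[OF \<alpha>] f(1)[OF \<beta>(1)], of k]
            triangle'[OF y_in f(1)[OF \<beta>(1)] f(1)[OF \<alpha>], of k] u
          by (simp add: abs_less_iff)
      qed
      then show "\<exists>n. \<forall>\<beta>\<in>C \<inter> cylinder n \<alpha>. \<bar>u (f \<beta>) - u (f \<alpha>)\<bar> < e"
        by blast
    qed
  qed
qed

end

lemma standard_borel_imp_polish_borel:
  assumes "standard_borel M" "space M \<noteq> {}"
  obtains d y where "polish_borel M d y"
proof -
  obtain T where T: "completely_metrizable_space T" "separable_space T" "topspace T = space M"
    "sets M = sigma_sets (topspace T) {U. openin T U}"
    using assms(1) unfolding standard_borel_def polish_topology_def by blast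
  obtain S d where Sd: "Metric_space S d" "Metric_space.mcomplete S d" "T = Metric_space.mtopology S d"
    using T(1) unfolding completely_metrizable_space_def by blast
  interpret S: Metric_space S d
    by (rule Sd(1))
  have S: "S = space M"
    using T(3) Sd(3) by simp
  obtain C where C: "countable C" "C \<subseteq> S" "S.mtopology closure_of C = S"
    using T(2) unfolding separable_space_def Sd(3) by auto
  have "C \<noteq> {}"
    using C(3) assms(2) S by auto
  define y where "y = from_nat_into C"
  have y_in: "y k \<in> S" for k
    using from_nat_into[OF \<open>C \<noteq> {}\<close>, of k] C(2) by (auto simp: y_def)
  have dense: "\<exists>k. d (y k) x < e" if x: "x \<in> S" and e: "e > 0" for x e
  proof -
    have "x \<in> S.mtopology closure_of C"
      using C(3) x by simp
    then obtain c where "c \<in> C" "c \<in> S.mball x e"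
      using e unfolding S.metric_closure_of by blast
    moreover obtain k where "y k = c"
      using from_nat_into_surj[OF C(1) \<open>c \<in> C\<close>] by (auto simp: y_def)
    ultimately show ?thesis
      by (intro exI[of _ k]) (simp add: S.commute)
  qed
  define B where "B = (\<lambda>(k, q). {x \<in> S. d (y k) x < q})"
  have B_open: "openin S.mtopology (B p)" for p
    using S.openin_mball[of "y (fst p)" "snd p"] y_in
    by (simp add: B_def S.mball_def case_prod_beta)
  have "sigma_sets S {U. openin S.mtopology U} = sigma_sets S (range B)"
  proof (rule sigma_sets_eqI)
    fix U assume "U \<in> {U. openin S.mtopology U}"
    then have U: "U \<subseteq> S" "\<And>x. x \<in> U \<Longrightarrow> \<exists>r>0. S.mball x r \<subseteq> U"
      by (auto simp: S.openin_mtopology)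
    define I where "I = {p :: nat \<times> rat. B (fst p, real_of_rat (snd p)) \<subseteq> U}"
    have "U = (\<Union>p\<in>I. B (fst p, real_of_rat (snd p)))"
    proof (intro equalityI subsetI)
      fix x assume x: "x \<in> U"
      then obtain r where r: "r > 0" "S.mball x r \<subseteq> U"
        using U(2) by blast
      obtain q where q: "0 < real_of_rat q" "real_of_rat q < r / 2"
        using of_rat_dense[of 0 "r / 2"] r(1) by auto
      have xS: "x \<in> S"
        using x U(1) by blast
      obtain k where k: "d (y k) x < real_of_rat q"
        using dense[OF xS q(1)] by blast
      have "B (k, real_of_rat q) \<subseteq> S.mball x r"
      proof
        fix z assume "z \<in> B (k, real_of_rat q)"
        then have "z \<in> S" "d (y k) z < real_of_rat q"
          by (auto simp: B_def)
        then show "z \<in> S.mball x r"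
          using S.triangle''[OF xS y_in \<open>z \<in> S\<close>, of k] k q(2) xS by simp
      qed
      then have "(k, q) \<in> I"
        using r(2) by (auto simp: I_def)
      moreover have "x \<in> B (k, real_of_rat q)"
        using xS k by (simp add: B_def)
      ultimately show "x \<in> (\<Union>p\<in>I. B (fst p, real_of_rat (snd p)))"
        by force
    qed (auto simp: I_def)
    moreover have "(\<Union>p\<in>I. B (fst p, real_of_rat (snd p))) \<in> sigma_sets S (range B)"
      by (intro sigma_sets_UNION) (auto intro: sigma_sets.Basic countable_subset)
    ultimately show "U \<in> sigma_sets S (range B)"
      by simp
  next
    fix A assume "A \<in> range B"
    then show "A \<in> sigma_sets S {U. openin S.mtopology U}"
      using B_open by (auto intro: sigma_sets.Basic)
  qed
  then have "sets M = sigma_sets (space M) (range (\<lambda>(k, q). {x \<in> space M. d (y k) x < q}))"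
    using T(3,4) unfolding Sd(3) S B_def by simp
  then have "polish_borel M d y"
    using Sd y_in dense unfolding S by (intro polish_borel.intro polish_borel_axioms.intro) auto
  then show ?thesis
    by (rule that)
qed

section \<open>Borel sets with at most one point in each section\<close>

locale polish_borel_pair = M: polish_borel M d y + N: polish_borel N e z
  for M :: "'a measure" and d y and N :: "'b measure" and e z
begin

definition pair_coords :: "('a \<times> 'b \<Rightarrow> real) set" where
  "pair_coords = (\<lambda>u p. u (fst p)) ` M.coords \<union> (\<lambda>v p. v (snd p)) ` N.coords"

lemma pair_coords_separate:
  assumes "p \<in> space M \<times> space N" "p' \<in> space M \<times> space N" "\<forall>w\<in>pair_coords. w p = w p'"
  shows "p = p'"
proof (rule prod_eqI)
  show "fst p = fst p'"
    using assms by (intro M.coords_separate) (auto simp: pair_coords_def ball_Un)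
  show "snd p = snd p'"
    using assms by (intro N.coords_separate) (auto simp: pair_coords_def ball_Un)
qed

text \<open>The identity is measurable from the \<open>\<sigma>\<close>-algebra of bianalytic subsets of the product to the product
\<open>\<sigma>\<close>-algebra, because both coordinate maps are.\<close>

lemma analytic_if_measurable:
  assumes "B \<in> sets (M \<Otimes>\<^sub>M N)"
  shows "analytic pair_coords B"
proof -
  define S where "S = space M \<times> space N"
  define \<B> where "\<B> = {A. A \<subseteq> S \<and> analytic pair_coords A \<and> analytic pair_coords (S - A)}"
  define L where "L = measure_of S \<B> (\<lambda>_. 0)"
  have S: "analytic pair_coords S"
    unfolding S_def pair_coords_def by (rule analytic_Times[OF M.analytic_space N.analytic_space])
  have "sigma_algebra S \<B>"
    unfolding \<B>_def
    by (rule bianalytic_sigma_algebra[OF S]) (simp_all add: S_def pair_coords_separate)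
  then have L: "sets L = \<B>" "space L = S"
    unfolding L_def by (simp_all add: sigma_algebra.sets_measure_of_eq sigma_algebra.space_measure_of_eq)
  have less: "{p \<in> S. w p < q} \<in> \<B>" if "w \<in> pair_coords" for w q
  proof -
    have "S - {p \<in> S. w p < q} = {p \<in> S. \<not> w p < q}"
      by auto
    then show ?thesis
      using bianalytic_less[OF S that, of q] by (auto simp: \<B>_def)
  qed
  have "fst \<in> L \<rightarrow>\<^sub>M M"
  proof (rule measurable_sigma_sets[OF M.sets_eq])
    fix A assume "A \<in> range (\<lambda>(k, q). {x \<in> space M. d (y k) x < q})"
    then obtain k q where "A = {x \<in> space M. d (y k) x < q}"
      by auto
    then have "fst -` A \<inter> space L = {p \<in> S. d (y k) (fst p) < q}"
      by (auto simp: L S_def)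
    then show "fst -` A \<inter> space L \<in> sets L"
      using less[of "\<lambda>p. d (y k) (fst p)" q] by (simp add: L pair_coords_def M.coords_def image_image)
  qed (auto simp: L S_def)
  moreover have "snd \<in> L \<rightarrow>\<^sub>M N"
  proof (rule measurable_sigma_sets[OF N.sets_eq])
    fix A assume "A \<in> range (\<lambda>(k, q). {x \<in> space N. e (z k) x < q})"
    then obtain k q where "A = {x \<in> space N. e (z k) x < q}"
      by auto
    then have "snd -` A \<inter> space L = {p \<in> S. e (z k) (snd p) < q}"
      by (auto simp: L S_def)
    then show "snd -` A \<inter> space L \<in> sets L"
      using less[of "\<lambda>p. e (z k) (snd p)" q] by (simp add: L pair_coords_def N.coords_def image_image)
  qed (auto simp: L S_def)
  ultimately have "(\<lambda>p. (fst p, snd p)) \<in> L \<rightarrow>\<^sub>M M \<Otimes>\<^sub>M N"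
    by (rule measurable_Pair)
  from measurable_sets[OF this assms] have "B \<inter> space L \<in> sets L"
    by (simp add: vimage_def)
  moreover have "B \<subseteq> S"
    using sets.sets_into_space[OF assms] by (simp add: S_def space_pair_measure)
  ultimately show ?thesis
    by (simp add: L \<B>_def Int_absorb2)
qed

lemma projections_separated:
  assumes "P \<in> sets (M \<Otimes>\<^sub>M N)" "Q \<in> sets (M \<Otimes>\<^sub>M N)" "fst ` P \<inter> fst ` Q = {}"
  shows "\<exists>S\<in>sets M. fst ` P \<subseteq> S \<and> S \<inter> fst ` Q = {}"
proof (rule lusin_separation)
  have "analytic M.coords (fst ` A)" "fst ` A \<subseteq> space M" if "A \<in> sets (M \<Otimes>\<^sub>M N)" for A
    using analytic_image[OF analytic_if_measurable[OF that], of M.coords fst]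
      sets.sets_into_space[OF that] by (auto simp: pair_coords_def space_pair_measure)
  then show "analytic M.coords (fst ` P)" "analytic M.coords (fst ` Q)"
    "fst ` P \<subseteq> space M" "fst ` Q \<subseteq> space M"
    using assms(1,2) by blast+
qed (use assms(3) M.coords_measurable M.coords_separate in auto)

text \<open>On \<open>B\<close>, the point \<open>x\<close> determines \<open>t\<close>. So for each \<open>q\<close> the points of \<open>B\<close> with \<open>v t < q\<close> and the other
points of \<open>B\<close> have disjoint projections; with a measurable set \<open>S q\<close> separating them, \<open>h x\<close> is the
infimum of all rational \<open>q\<close> with \<open>x \<in> S q\<close>.\<close>

lemma extend_along_graph:
  fixes v :: "'b \<Rightarrow> real"
  assumes B: "B \<in> sets (M \<Otimes>\<^sub>M N)" and "single_valued B" and v[measurable]: "v \<in> borel_measurable N"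
  shows "\<exists>h\<in>borel_measurable M. \<forall>(x, t)\<in>B. h x = v t"
proof -
  have BS: "B \<subseteq> space M \<times> space N"
    using sets.sets_into_space[OF B] by (simp add: space_pair_measure)
  have "\<exists>S\<in>sets M. \<forall>(x, t)\<in>B. x \<in> S \<longleftrightarrow> v t < q" for q
  proof -
    define G where "G = {p \<in> space (M \<Otimes>\<^sub>M N). v (snd p) < q}"
    have G: "G \<in> sets (M \<Otimes>\<^sub>M N)"
      unfolding G_def by measurable
    have G_iff: "p \<in> G \<longleftrightarrow> v (snd p) < q" if "p \<in> B" for p
      using BS that by (auto simp: G_def space_pair_measure)
    have "fst ` (B \<inter> G) \<inter> fst ` (B - G) = {}"
      using assms(2) G_iff by (fastforce dest: single_valuedD)
    then obtain S where "S \<in> sets M" "fst ` (B \<inter> G) \<subseteq> S" "S \<inter> fst ` (B - G) = {}"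
      using projections_separated[of "B \<inter> G" "B - G"] B G by blast
    then show ?thesis
      using G_iff by (intro bexI[of _ S]) force+
  qed
  then obtain S where S[measurable]: "\<And>q. S q \<in> sets M"
    and S_iff: "\<And>q x t. (x, t) \<in> B \<Longrightarrow> x \<in> S q \<longleftrightarrow> v t < q"
    by (metis (mono_tags, lifting) case_prodD)
  \<comment> \<open>The infimum is taken in the extended reals, as nothing is known about \<open>S\<close> outside the projection of \<open>B\<close>.\<close>
  define h where "h x = real_of_ereal (INF q\<in>\<rat>. if x \<in> S q then ereal q else \<infinity>)" for x
  have "h \<in> borel_measurable M"
    unfolding h_def using countable_rat by measurable
  moreover have "h x = v t" if xt: "(x, t) \<in> B" for x t
  proof -
    have "(INF q\<in>\<rat>. if x \<in> S q then ereal q else \<infinity>) = ereal (v t)"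
    proof (rule antisym)
      show "(INF q\<in>\<rat>. if x \<in> S q then ereal q else \<infinity>) \<le> ereal (v t)"
      proof (rule dense_ge)
        fix r assume "ereal (v t) < r"
        then obtain b where b: "v t < b" "ereal b < r"
          using ereal_dense2 by fastforce
        then obtain q where q: "q \<in> \<rat>" "v t < q" "q < b"
          using Rats_dense_in_real by blast
        have "x \<in> S q"
          using S_iff[OF xt] q(2) by simp
        moreover have "ereal q \<le> r"
          using less_trans[of "ereal q" "ereal b" r] q(3) b(2) by simp
        ultimately show "(INF q\<in>\<rat>. if x \<in> S q then ereal q else \<infinity>) \<le> r"
          using q(1) by (intro INF_lower2) auto
      qed
      show "ereal (v t) \<le> (INF q\<in>\<rat>. if x \<in> S q then ereal q else \<infinity>)"
        using S_iff[OF xt] by (intro INF_greatest) auto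
    qed
    then show ?thesis
      by (simp add: h_def)
  qed
  ultimately show ?thesis
    by blast
qed

text \<open>A special case of the Lusin-Souslin theorem. The functions \<open>h k\<close> predict from \<open>x\<close> the distances of \<open>t\<close>
to the dense sequence. A sequence of numbers is the sequence of distances from some point iff it
satisfies countably many inequalities, so the set \<open>X\<close> of all \<open>x\<close> with a consistent prediction is
measurable, even where \<open>x\<close> is outside the projection of \<open>B\<close>; \<open>g x\<close> is the point predicted.\<close>

theorem injective_projection_measurable:
  assumes B: "B \<in> sets (M \<Otimes>\<^sub>M N)" and "single_valued B"
  shows "fst ` B \<in> sets M"
proof -
  have BS: "B \<subseteq> space M \<times> space N"
    using sets.sets_into_space[OF B] by (simp add: space_pair_measure)
  have "\<exists>h\<in>borel_measurable M. \<forall>(x, t)\<in>B. h x = e (z k) t" for k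
    by (intro extend_along_graph assms N.coords_measurable) (simp add: N.coords_def)
  then obtain h where h[measurable]: "\<And>k. h k \<in> borel_measurable M"
    and h_eq: "\<And>k x t. (x, t) \<in> B \<Longrightarrow> h k x = e (z k) t"
    by (metis (mono_tags, lifting) case_prodD)
  define X where "X = {x \<in> space M. (\<forall>n. \<exists>k. h k x < inverse (real (Suc n))) \<and>
      (\<forall>k l. e (z k) (z l) \<le> h k x + h l x \<and> h k x \<le> e (z k) (z l) + h l x)}"
  have X: "X \<in> sets M"
    unfolding X_def by measurable
  have "\<exists>t\<in>space N. \<forall>k. e (z k) t = h k x" if x: "x \<in> X" for x
  proof -
    obtain \<kappa> where \<kappa>: "\<And>n. h (\<kappa> n) x < inverse (real (Suc n))"
    proof -
      have "\<forall>n. \<exists>k. h k x < inverse (real (Suc n))"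
        using x by (simp add: X_def del: of_nat_Suc)
      then show ?thesis
        using that by metis
    qed
    have lower: "e (z k) (z l) \<le> h k x + h l x" and upper: "h k x \<le> e (z k) (z l) + h l x" for k l
      using x by (auto simp: X_def)
    have "e (z (\<kappa> n)) (z (\<kappa> m)) \<le> inverse (real (Suc n)) + inverse (real (Suc m))" for n m
      using lower[of "\<kappa> n" "\<kappa> m"] \<kappa>[of n] \<kappa>[of m] by linarith
    then obtain t where t: "t \<in> space N" "\<And>n. e (z (\<kappa> n)) t \<le> inverse (real (Suc n))"
      using N.Cauchy_limit[OF N.y_in LIMSEQ_inverse_real_of_nat] by blast
    \<comment> \<open>Both numbers are within \<open>inverse (Suc n)\<close> of the distance from \<open>z k\<close> to \<open>z (\<kappa> n)\<close>, for every \<open>n\<close>.\<close>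
    have "\<bar>e (z k) t - h k x\<bar> \<le> 0" for k
    proof (rule field_le_epsilon)
      fix \<epsilon> :: real assume "\<epsilon> > 0"
      then obtain n where n: "inverse (real (Suc n)) < \<epsilon> / 2"
        using reals_Archimedean[of "\<epsilon> / 2"] by auto
      show "\<bar>e (z k) t - h k x\<bar> \<le> 0 + \<epsilon>"
        using n lower[of k "\<kappa> n"] upper[of k "\<kappa> n"] \<kappa>[of n] t(2)[of n]
          N.triangle[OF N.y_in N.y_in t(1), of k "\<kappa> n"] N.triangle'[OF N.y_in t(1) N.y_in, of k "\<kappa> n"]
        by (simp add: abs_le_iff)
    qed
    then show ?thesis
      using t(1) by (intro bexI[of _ t]) auto
  qed
  then obtain g where g: "\<And>x. x \<in> X \<Longrightarrow> g x \<in> space N" "\<And>x k. x \<in> X \<Longrightarrow> e (z k) (g x) = h k x"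
    by metis
  have graph: "x \<in> X \<and> g x = t" if xt: "(x, t) \<in> B" for x t
  proof -
    have in_space: "x \<in> space M" "t \<in> space N"
      using BS xt by auto
    have "x \<in> X"
      unfolding X_def
    proof (intro CollectI conjI allI)
      show "\<exists>k. h k x < inverse (real (Suc n))" for n
        using N.dense[OF in_space(2), of "inverse (real (Suc n))"] by (simp add: h_eq[OF xt])
      show "e (z k) (z l) \<le> h k x + h l x" for k l
        unfolding h_eq[OF xt] by (rule N.triangle'[OF N.y_in in_space(2) N.y_in])
      show "h k x \<le> e (z k) (z l) + h l x" for k l
        unfolding h_eq[OF xt] by (rule N.triangle[OF N.y_in N.y_in in_space(2)])
    qed (rule in_space(1))
    then show ?thesis
      using N.coords_separate[OF g(1) in_space(2)] g(2) h_eq[OF xt] by (auto simp: N.coords_def)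
  qed
  have g_meas: "g \<in> restrict_space M X \<rightarrow>\<^sub>M N"
  proof (rule measurable_sigma_sets[OF N.sets_eq])
    fix A assume "A \<in> range (\<lambda>(k, q). {t \<in> space N. e (z k) t < q})"
    then obtain k q where "A = {t \<in> space N. e (z k) t < q}"
      by auto
    then have "g -` A \<inter> space (restrict_space M X) = {x \<in> space M. h k x < q} \<inter> X"
      using g sets.sets_into_space[OF X] by (auto simp: space_restrict_space)
    also have "\<dots> \<in> sets (restrict_space M X)"
      using X by (auto simp: sets_restrict_space_iff)
    finally show "g -` A \<inter> space (restrict_space M X) \<in> sets (restrict_space M X)" .
  qed (use g sets.sets_into_space[OF X] in \<open>auto simp: space_restrict_space\<close>)
  have "(\<lambda>x. (x, g x)) \<in> restrict_space M X \<rightarrow>\<^sub>M M \<Otimes>\<^sub>M N"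
    by (intro measurable_Pair g_meas measurable_restrict_space1) simp
  from measurable_sets[OF this B]
  have "(\<lambda>x. (x, g x)) -` B \<inter> space (restrict_space M X) \<in> sets (restrict_space M X)" .
  moreover have "(\<lambda>x. (x, g x)) -` B \<inter> space (restrict_space M X) = {x \<in> X. (x, g x) \<in> B}"
    using sets.sets_into_space[OF X] by (auto simp: space_restrict_space)
  moreover have "fst ` B = {x \<in> X. (x, g x) \<in> B}"
    using graph by force
  ultimately show ?thesis
    using X by (simp add: sets_restrict_space_iff)
qed

end

section \<open>Points and cardinality of standard Borel spaces\<close>

lemma (in polish_borel) singleton_measurable:
  assumes "x \<in> space M"
  shows "{x} \<in> sets M"
proof -
  have [measurable]: "d (y k) \<in> borel_measurable M" for k
    by (rule coords_measurable) (simp add: coords_def)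
  have "{x} = {x' \<in> space M. \<forall>k. d (y k) x' = d (y k) x}"
    using assms coords_separate by (auto simp: coords_def)
  also have "\<dots> \<in> sets M"
    by measurable
  finally show ?thesis .
qed

text \<open>The points all of whose basic neighborhoods are uncountable (the condensation points) form a perfect
set \<open>K\<close>. Only countably many points are removed, so \<open>K\<close> is nonempty.\<close>

lemma (in polish_borel) uncountable_imp_continuum:
  assumes "uncountable (space M)"
  shows "(UNIV :: real set) \<lesssim> space M"
proof -
  define B where "B p = {x \<in> space M. d (y (fst p)) x < real_of_rat (snd p)}" for p :: "nat \<times> rat"
  define K where "K = space M - (\<Union>p\<in>{p. countable (B p)}. B p)"
  have "countable (\<Union>p\<in>{p. countable (B p)}. B p)"
    by (rule countable_UN) auto
  then have diff: "uncountable (A \<inter> K)" if "uncountable A" "A \<subseteq> space M" for A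
  proof -
    have "A - (\<Union>p\<in>{p. countable (B p)}. B p) = A \<inter> K"
      using that(2) by (auto simp: K_def)
    then show ?thesis
      using uncountable_minus_countable[OF that(1)] \<open>countable (\<Union>p\<in>{p. countable (B p)}. B p)\<close> by metis
  qed
  have "mtopology derived_set_of K = K"
  proof (intro equalityI subsetI)
    fix x assume "x \<in> mtopology derived_set_of K"
    then have x: "x \<in> space M" "\<And>r. r > 0 \<Longrightarrow> \<exists>x'\<in>K. x' \<in> mball x r"
      unfolding metric_derived_set_of by blast+
    have "uncountable (B p)" if p: "x \<in> B p" for p
    proof -
      have "real_of_rat (snd p) - d (y (fst p)) x > 0"
        using p by (simp add: B_def)
      then obtain x' where x': "x' \<in> K" "x' \<in> mball x (real_of_rat (snd p) - d (y (fst p)) x)"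
        using x(2) by blast
      then have "x' \<in> B p"
        using triangle[OF y_in x(1), of x' "fst p"] by (simp add: B_def)
      then show ?thesis
        using x'(1) unfolding K_def by blast
    qed
    then show "x \<in> K"
      using x(1) by (auto simp: K_def)
  next
    fix x assume "x \<in> K"
    then have x: "x \<in> space M" "\<And>p. x \<in> B p \<Longrightarrow> uncountable (B p)"
      by (auto simp: K_def)
    have "\<exists>x'\<in>K. x' \<noteq> x \<and> x' \<in> mball x r" if "r > 0" for r
    proof -
      obtain q where q: "0 < real_of_rat q" "real_of_rat q < r / 2"
        using of_rat_dense[of 0 "r / 2"] \<open>r > 0\<close> by auto
      obtain k where k: "d (y k) x < real_of_rat q"
        using dense[OF x(1) q(1)] by blast
      have "x \<in> B (k, q)"
        using x(1) k by (simp add: B_def)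
      moreover have "B (k, q) \<subseteq> space M"
        by (auto simp: B_def)
      ultimately have "uncountable (B (k, q) \<inter> K - {x})"
        using x(2) diff by (intro uncountable_minus_countable) auto
      then have "B (k, q) \<inter> K - {x} \<noteq> {}"
        by force
      then obtain x' where x': "x' \<in> B (k, q)" "x' \<in> K" "x' \<noteq> x"
        by blast
      then have "x' \<in> mball x r"
        using triangle''[OF x(1) y_in, of x' k] k q(2) x(1) by (simp add: B_def)
      then show ?thesis
        using x' by blast
    qed
    then show "x \<in> mtopology derived_set_of K"
      unfolding metric_derived_set_of using x(1) by blast
  qed
  moreover have "K \<noteq> {}"
    using diff[OF assms] by force
  ultimately have "(UNIV :: real set) \<lesssim> K"
    by (rule lepoll_perfect_set[OF complete])
  then show ?thesis
    by (rule lepoll_trans[OF _ subset_imp_lepoll]) (auto simp: K_def)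
qed

section \<open>Distinguishing colorings of a union of complete graphs\<close>

text \<open>Both the transposition of two points and the exchange of two classes are involutions. For an involution
it suffices to check that \<open>E\<close> is preserved in one direction, and bijectivity is automatic.\<close>

lemma color_preserving_involution_trivial:
  assumes "distinguishing_coloring V (E - Id_on V) c"
    and in_V: "\<And>x. x \<in> V \<Longrightarrow> \<phi> x \<in> V" and inv: "\<And>x. x \<in> V \<Longrightarrow> \<phi> (\<phi> x) = x"
    and E: "\<And>x y. x \<in> V \<Longrightarrow> y \<in> V \<Longrightarrow> (x, y) \<in> E \<Longrightarrow> (\<phi> x, \<phi> y) \<in> E"
    and c: "\<And>x. x \<in> V \<Longrightarrow> c (\<phi> x) = c x"
    and "x \<in> V"
  shows "\<phi> x = x"
proof -
  define \<psi> where "\<psi> = restrict \<phi> V"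
  have \<psi>: "\<psi> x = \<phi> x" if "x \<in> V" for x
    using that by (simp add: \<psi>_def)
  have non_loop: "(x, y) \<in> E - Id_on V \<longleftrightarrow> (x, y) \<in> E \<and> x \<noteq> y" if "x \<in> V" for x y
    using that by blast
  have "bij_betw \<psi> V V"
    by (rule bij_betw_byWitness[of _ \<psi>]) (auto simp: \<psi>_def in_V inv)
  moreover have "(x, y) \<in> E - Id_on V \<longleftrightarrow> (\<psi> x, \<psi> y) \<in> E - Id_on V" if xy: "x \<in> V" "y \<in> V" for x y
  proof -
    have "(x, y) \<in> E \<longleftrightarrow> (\<phi> x, \<phi> y) \<in> E"
      using E[OF xy] E[OF in_V in_V] inv xy by metis
    moreover have "x = y \<longleftrightarrow> \<phi> x = \<phi> y"
      using inv xy by metis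
    ultimately show ?thesis
      unfolding \<psi>[OF xy(1)] \<psi>[OF xy(2)] non_loop[OF xy(1)] non_loop[OF in_V[OF xy(1)]] by blast
  qed
  ultimately have "\<psi> \<in> graph_Aut V (E - Id_on V)"
    by (simp add: graph_Aut_def \<psi>_def)
  moreover have "\<forall>x\<in>V. c x = c (\<psi> x)"
    using c by (simp add: \<psi>_def)
  ultimately have "\<psi> = (\<lambda>x\<in>V. x)"
    using assms(1) unfolding distinguishing_coloring_def by blast
  then have "\<psi> x = (\<lambda>x\<in>V. x) x"
    by simp
  then show ?thesis
    using \<open>x \<in> V\<close> by (simp add: \<psi>_def)
qed

text \<open>Otherwise the transposition of two equally colored points of a class would be a nontrivial
color-preserving automorphism.\<close>

lemma distinguishing_inj_on_class:
  assumes E: "equiv V E" and c: "distinguishing_coloring V (E - Id_on V) c" and C: "C \<in> V // E"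
  shows "inj_on c C"
proof (rule inj_onI)
  fix a b assume ab: "a \<in> C" "b \<in> C" "c a = c b"
  have V: "a \<in> V" "b \<in> V"
    using ab(1,2) in_quotient_imp_subset[OF E C] by auto
  have abE: "(a, b) \<in> E" "(b, a) \<in> E"
    using quotient_eq_iff[OF E C C] ab by auto
  define \<phi> where "\<phi> x = (if x = a then b else if x = b then a else x)" for x
  have xE: "(x, \<phi> x) \<in> E" if "x \<in> V" for x
    using that abE E by (auto simp: \<phi>_def equiv_def refl_on_def)
  have "\<phi> a = a"
  proof (rule color_preserving_involution_trivial[OF c])
    show "(\<phi> x, \<phi> y) \<in> E" if "x \<in> V" "y \<in> V" "(x, y) \<in> E" for x y
      using xE that E by (meson equivE symE transE)
  qed (use V ab(3) in \<open>auto simp: \<phi>_def\<close>)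
  then show "a = b"
    by (simp add: \<phi>_def)
qed

text \<open>Otherwise two classes with the same set of colors could be exchanged by sending each point to the
point of the other class that has the same color.\<close>

lemma distinguishing_inj_on_color_sets:
  assumes E: "equiv V E" and c: "distinguishing_coloring V (E - Id_on V) c"
  shows "inj_on (\<lambda>C. c ` C) (V // E)"
proof (rule inj_onI, rule ccontr)
  fix C D assume CD: "C \<in> V // E" "D \<in> V // E" "c ` C = c ` D" "C \<noteq> D"
  have disj: "C \<inter> D = {}"
    using quotient_disj[OF E CD(1,2)] CD(4) by blast
  have sub: "C \<subseteq> V" "D \<subseteq> V"
    using in_quotient_imp_subset[OF E] CD by auto
  have inj: "inj_on c C" "inj_on c D"
    using distinguishing_inj_on_class[OF E c] CD by auto
  define p where "p = (\<lambda>z. inv_into D c (c z))"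
  define q where "q = (\<lambda>z. inv_into C c (c z))"
  have p: "p z \<in> D" "c (p z) = c z" "q (p z) = z" if "z \<in> C" for z
  proof -
    have "c z \<in> c ` D"
      using that CD(3) by blast
    then show "p z \<in> D" "c (p z) = c z"
      unfolding p_def by (simp_all add: inv_into_into f_inv_into_f)
    then show "q (p z) = z"
      using inj(1) that by (simp add: q_def)
  qed
  have q: "q z \<in> C" "c (q z) = c z" "p (q z) = z" if "z \<in> D" for z
  proof -
    have "c z \<in> c ` C"
      using that CD(3) by blast
    then show "q z \<in> C" "c (q z) = c z"
      unfolding q_def by (simp_all add: inv_into_into f_inv_into_f)
    then show "p (q z) = z"
      using inj(2) that by (simp add: p_def)
  qed
  define \<phi> where "\<phi> z = (if z \<in> C then p z else if z \<in> D then q z else z)" for z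
  have \<phi>: "\<phi> z = p z" if "z \<in> C" for z
    using that by (simp add: \<phi>_def)
  have \<phi>': "\<phi> z = q z" if "z \<in> D" for z
    using that disj by (auto simp: \<phi>_def)
  have \<phi>'': "\<phi> z = z" if "z \<notin> C" "z \<notin> D" for z
    using that by (simp add: \<phi>_def)
  obtain x where "x \<in> C"
    using in_quotient_imp_non_empty[OF E CD(1)] by blast
  have "\<phi> x = x"
  proof (rule color_preserving_involution_trivial[OF c])
    show "\<phi> z \<in> V" if "z \<in> V" for z
      using that p(1) q(1) sub by (auto simp: \<phi>_def)
    show "\<phi> (\<phi> z) = z" for z
      by (cases "z \<in> C"; cases "z \<in> D") (simp_all add: \<phi> \<phi>' \<phi>'' p q)
    show "c (\<phi> z) = c z" for z
      by (cases "z \<in> C"; cases "z \<in> D") (simp_all add: \<phi> \<phi>' \<phi>'' p q)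
    show "(\<phi> u, \<phi> v) \<in> E" if "u \<in> V" "v \<in> V" "(u, v) \<in> E" for u v
    proof -
      have "u \<in> C \<longleftrightarrow> v \<in> C" "u \<in> D \<longleftrightarrow> v \<in> D"
        using that(3) in_quotient_imp_closed[OF E] CD(1,2) E by (meson equivE symE)+
      then consider "u \<in> C" "v \<in> C" | "u \<in> D" "v \<in> D" | "u \<notin> C" "u \<notin> D" "v \<notin> C" "v \<notin> D"
        by blast
      then show ?thesis
      proof cases
        case 1
        then show ?thesis
          using quotient_eq_iff[OF E CD(2) CD(2)] p(1) by (simp add: \<phi>)
      next
        case 2
        then show ?thesis
          using quotient_eq_iff[OF E CD(1) CD(1)] q(1) by (simp add: \<phi>')
      qed (use that(3) in \<open>simp add: \<phi>''\<close>)
    qed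
  qed (use \<open>x \<in> C\<close> sub in blast)
  then show False
    using p(1)[OF \<open>x \<in> C\<close>] \<open>x \<in> C\<close> disj by (auto simp: \<phi>)
qed

text \<open>An automorphism maps classes onto classes. If it preserves colors, then it fixes every class, since the
set of colors identifies the class, and then every point, since the color identifies the point in its
class.\<close>

lemma distinguishing_coloringI:
  assumes E: "equiv V E"
    and inj: "\<And>C. C \<in> V // E \<Longrightarrow> inj_on c C"
    and sets: "inj_on (\<lambda>C. c ` C) (V // E)"
  shows "distinguishing_coloring V (E - Id_on V) c"
  unfolding distinguishing_coloring_def
proof (rule ballI, rule ccontr)
  fix \<phi> assume \<phi>: "\<phi> \<in> graph_Aut V (E - Id_on V) - {\<lambda>x\<in>V. x}"
  assume "\<not> (\<exists>x\<in>V. c x \<noteq> c (\<phi> x))"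
  then have c: "\<And>x. x \<in> V \<Longrightarrow> c (\<phi> x) = c x"
    by metis
  have bij: "bij_betw \<phi> V V" and ext: "\<phi> \<in> extensional V"
    using \<phi> by (auto simp: graph_Aut_def)
  have in_V: "\<phi> x \<in> V" if "x \<in> V" for x
    using bij that by (auto simp: bij_betw_def)
  have E_iff: "(x, y) \<in> E \<longleftrightarrow> (\<phi> x, \<phi> y) \<in> E" if xy: "x \<in> V" "y \<in> V" for x y
  proof (cases "x = y")
    case True
    then show ?thesis
      using xy in_V E by (auto simp: equiv_def refl_on_def)
  next
    case False
    then have "\<phi> x \<noteq> \<phi> y"
      using bij xy by (auto simp: bij_betw_def dest: inj_onD)
    moreover have "(x, y) \<in> E - Id_on V \<longleftrightarrow> (\<phi> x, \<phi> y) \<in> E - Id_on V"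
      using \<phi> xy by (simp add: graph_Aut_def)
    ultimately show ?thesis
      using False by auto
  qed
  have "\<phi> x = x" if x: "x \<in> V" for x
  proof -
    have "c ` (E `` {x}) = c ` (E `` {\<phi> x})"
    proof (intro equalityI subsetI)
      fix i assume "i \<in> c ` (E `` {x})"
      then obtain y where y: "(x, y) \<in> E" "i = c y"
        by auto
      then have "y \<in> V"
        using E by (auto simp: equiv_def refl_on_def)
      then show "i \<in> c ` (E `` {\<phi> x})"
        using y c E_iff[OF x] by (intro image_eqI[of _ _ "\<phi> y"]) auto
    next
      fix i assume "i \<in> c ` (E `` {\<phi> x})"
      then obtain w where w: "(\<phi> x, w) \<in> E" "i = c w"
        by auto
      then have "w \<in> V"
        using E by (auto simp: equiv_def refl_on_def)
      then obtain y where y: "y \<in> V" "w = \<phi> y"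
        using bij by (auto simp: bij_betw_def)
      then show "i \<in> c ` (E `` {x})"
        using w c E_iff[OF x] by (intro image_eqI[of _ _ y]) auto
    qed
    moreover have "E `` {x} \<in> V // E" "E `` {\<phi> x} \<in> V // E"
      using x in_V by (auto intro: quotientI)
    ultimately have "E `` {x} = E `` {\<phi> x}"
      using sets by (auto dest: inj_onD)
    then have "\<phi> x \<in> E `` {x}" "x \<in> E `` {x}"
      using x in_V equiv_class_self[OF E] by auto
    then show ?thesis
      using inj[OF quotientI[OF x]] c[OF x] by (auto dest: inj_onD)
  qed
  then have "\<phi> = (\<lambda>x\<in>V. x)"
    using ext by (auto simp: fun_eq_iff extensional_def)
  then show False
    using \<phi> by simp
qed

text \<open>The function \<open>r\<close> bounds the number of classes by the continuum, so there are enough subsets of \<open>nat\<close> to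
label them. Each class is colored bijectively by an infinite set of numbers \<open>A C\<close> that encodes its label.\<close>

lemma exists_distinguishing_nat_coloring:
  assumes E: "equiv V E" and C: "\<And>C. C \<in> V // E \<Longrightarrow> countable C \<and> infinite C"
    and r: "inj_on (r :: 'a \<Rightarrow> real) V"
  shows "\<exists>c :: 'a \<Rightarrow> nat. distinguishing_coloring V (E - Id_on V) c"
proof -
  obtain k :: "real \<Rightarrow> nat set" where k: "inj k"
    using eqpoll_sym[OF nat_sets_eqpoll_reals] unfolding eqpoll_def bij_betw_def by blast
  define rep where "rep C = (SOME x. x \<in> C)" for C :: "'a set"
  have rep: "rep C \<in> C" if "C \<in> V // E" for C
    unfolding rep_def using in_quotient_imp_non_empty[OF E that] by (simp add: some_in_eq)
  \<comment> \<open>The odd members encode the label of \<open>C\<close>; the even numbers make the set infinite.\<close>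
  define A where "A C = range (\<lambda>n. 2 * n) \<union> (\<lambda>n. Suc (2 * n)) ` k (r (rep C))" for C
  have A_odd: "Suc (2 * n) \<in> A C \<longleftrightarrow> n \<in> k (r (rep C))" for n C
  proof -
    have "Suc (2 * n) \<noteq> 2 * m" for m
      by presburger
    then show ?thesis
      by (auto simp: A_def)
  qed
  have A_inj: "inj_on A (V // E)"
  proof (rule inj_onI)
    fix C D assume CD: "C \<in> V // E" "D \<in> V // E" "A C = A D"
    then have "k (r (rep C)) = k (r (rep D))"
      using A_odd[of _ C] A_odd[of _ D] by auto
    then have "r (rep C) = r (rep D)"
      using k by (auto dest: injD)
    then have "rep C = rep D"
      using r rep CD(1,2) in_quotient_imp_subset[OF E] by (meson inj_onD subsetD)
    then show "C = D"
      using quotient_disj[OF E CD(1,2)] rep[OF CD(1)] rep[OF CD(2)] by auto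
  qed
  have "infinite (range (\<lambda>n :: nat. 2 * n))"
    by (intro range_inj_infinite injI) simp
  then have A_inf: "infinite (A C)" for C
    by (simp add: A_def)
  have "\<exists>b. bij_betw b C (A C)" if "C \<in> V // E" for C
  proof -
    have "bij_betw (to_nat_on C) C UNIV"
      using C[OF that] by (simp add: to_nat_on_infinite)
    moreover have "bij_betw (from_nat_into (A C)) UNIV (A C)"
      using A_inf by (intro bij_betw_from_nat_into) auto
    ultimately show ?thesis
      using bij_betw_trans by blast
  qed
  then obtain b where b: "\<And>C. C \<in> V // E \<Longrightarrow> bij_betw (b C) C (A C)"
    by metis
  define c where "c x = b (E `` {x}) x" for x
  have c: "c x = b C x" if "C \<in> V // E" "x \<in> C" for C x
    using that E by (auto simp: c_def elim!: quotientE dest: equiv_class_eq)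
  have "distinguishing_coloring V (E - Id_on V) c"
  proof (rule distinguishing_coloringI[OF E])
    show "inj_on c C" if "C \<in> V // E" for C
      using b[OF that] c[OF that] by (auto simp: bij_betw_def cong: inj_on_cong)
    have "c ` C = A C" if "C \<in> V // E" for C
      using b[OF that] c[OF that] by (auto simp: bij_betw_def cong: image_cong)
    then show "inj_on (\<lambda>C. c ` C) (V // E)"
      using A_inj by (simp cong: inj_on_cong)
  qed
  then show ?thesis
    by (rule exI[of _ c])
qed

section \<open>Countably many colors force smoothness\<close>

lemma standard_borel_borel: "standard_borel (borel :: 'a :: polish_space measure)"
  unfolding standard_borel_def polish_topology_def
proof (intro exI[of _ euclidean] conjI)
  show "completely_metrizable_space (euclidean :: 'a topology)"
    by (rule completely_metrizable_space_euclidean)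
  obtain D :: "'a set" where "countable D" "\<And>X. open X \<Longrightarrow> X \<noteq> {} \<Longrightarrow> \<exists>d\<in>D. d \<in> X"
    using countable_dense_exists by blast
  then have "- closure D = {}"
    using closure_subset[of D] by (metis ComplD closed_closure open_Compl subsetD)
  then have "closure D = UNIV"
    by blast
  then show "separable_space (euclidean :: 'a topology)"
    using \<open>countable D\<close> unfolding separable_space_def by (intro exI[of _ D]) simp
qed (simp_all add: borel_def)

lemma smooth_if_empty:
  assumes "space M = {}"
  shows "smooth M E"
  by (rule smoothI[OF standard_borel_borel, of "\<lambda>_. 0 :: real"]) (simp_all add: assms)

text \<open>The witness of smoothness lists, for each color, whether it occurs on the class of \<open>x\<close>. The set \<open>P i\<close>
of points whose class contains the color \<open>i\<close> is the projection of a measurable set whose sections have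
at most one point, because \<open>c\<close> is injective on classes.\<close>

lemma smooth_if_countably_many_colors:
  assumes M: "standard_borel M" and E: "borel_equiv M E"
    and N: "standard_borel N" "countable (space N)"
    and c: "c \<in> M \<rightarrow>\<^sub>M N" "distinguishing_coloring (space M) (E - Id_on (space M)) c"
  shows "smooth M E"
proof (cases "space M = {}")
  case False
  have eq: "equiv (space M) E" and E_sets: "E \<in> sets (M \<Otimes>\<^sub>M M)"
    using E by (auto simp: borel_equiv_def)
  have "space N \<noteq> {}"
    using False measurable_space[OF c(1)] by blast
  obtain d y where d: "polish_borel M d y"
    using standard_borel_imp_polish_borel[OF M False] .
  interpret polish_borel_pair M d y M d y
    using d by (rule polish_borel_pair.intro[OF d])
  obtain d' y' where "polish_borel N d' y'"
    using standard_borel_imp_polish_borel[OF N(1) \<open>space N \<noteq> {}\<close>] .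
  then interpret N: polish_borel N d' y' .
  define P where "P i = {x \<in> space M. \<exists>t. (x, t) \<in> E \<and> c t = i}" for i
  have E_sub: "E \<subseteq> space M \<times> space M"
    using sets.sets_into_space[OF E_sets] by (simp add: space_pair_measure)
  have P: "P i \<in> sets M" if "i \<in> space N" for i
  proof -
    define B where "B = E \<inter> {p. c (snd p) = i}"
    have "(\<lambda>p. c (snd p)) \<in> M \<Otimes>\<^sub>M M \<rightarrow>\<^sub>M N"
      using c(1) by measurable
    from measurable_sets[OF this N.singleton_measurable[OF that]]
    have "{p \<in> space (M \<Otimes>\<^sub>M M). c (snd p) = i} \<in> sets (M \<Otimes>\<^sub>M M)"
      by (simp add: vimage_def Int_def conj_commute)
    moreover have "B = E \<inter> {p \<in> space (M \<Otimes>\<^sub>M M). c (snd p) = i}"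
      using E_sub by (auto simp: B_def space_pair_measure)
    ultimately have "B \<in> sets (M \<Otimes>\<^sub>M M)"
      using E_sets by simp
    moreover have "single_valued B"
    proof (rule single_valuedI)
      fix x t t' assume "(x, t) \<in> B" "(x, t') \<in> B"
      then have *: "(x, t) \<in> E" "(x, t') \<in> E" "c t = c t'"
        by (auto simp: B_def)
      then have "E `` {x} \<in> space M // E"
        using E_sub by (auto intro: quotientI)
      then show "t = t'"
        using distinguishing_inj_on_class[OF eq c(2)] * by (auto dest: inj_onD)
    qed
    ultimately have "fst ` B \<in> sets M"
      by (rule injective_projection_measurable)
    moreover have "fst ` B = P i"
      using E_sub by (force simp: B_def P_def)
    ultimately show ?thesis
      by simp
  qed
  define f where "f x = (\<lambda>k. indicator (P (from_nat_into (space N) k)) x :: real)" for x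
  show ?thesis
  proof (rule smoothI[OF standard_borel_borel])
    have "(\<lambda>x. f x k) \<in> borel_measurable M" for k
      unfolding f_def using P[OF from_nat_into[OF \<open>space N \<noteq> {}\<close>]] by measurable
    then show "f \<in> borel_measurable M"
      by (rule measurable_coordinatewise_then_product)
    fix x x' assume x: "x \<in> space M" "x' \<in> space M"
    have P_iff: "x \<in> P i \<longleftrightarrow> i \<in> c ` (E `` {x})" if "x \<in> space M" for x i
      using that by (auto simp: P_def)
    show "(x, x') \<in> E \<longleftrightarrow> f x = f x'"
    proof
      assume "(x, x') \<in> E"
      then have "E `` {x} = E `` {x'}"
        by (rule equiv_class_eq[OF eq])
      then show "f x = f x'"
        using x by (simp add: f_def indicator_def P_iff)
    next
      assume "f x = f x'"
      then have f_eq: "f x k = f x' k" for k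
        by simp
      have "i \<in> c ` (E `` {x}) \<longleftrightarrow> i \<in> c ` (E `` {x'})" for i
      proof (cases "i \<in> space N")
        case True
        then obtain k where "from_nat_into (space N) k = i"
          using from_nat_into_surj[OF N(2)] by blast
        then show ?thesis
          using f_eq[of k] x by (auto simp: f_def P_iff indicator_def split: if_splits)
      next
        case False
        then show ?thesis
          using E_sub measurable_space[OF c(1)] by blast
      qed
      then have "c ` (E `` {x}) = c ` (E `` {x'})"
        by blast
      then have "E `` {x} = E `` {x'}"
        using distinguishing_inj_on_color_sets[OF eq c(2)] x by (auto dest: inj_onD intro: quotientI)
      then show "(x, x') \<in> E"
        using eq_equiv_class[OF _ eq x(2)] by simp
    qed
  qed
qed (rule smooth_if_empty)

section \<open>The distinguishing numbers\<close>

lemma card_of_reals: "|UNIV :: real set| =o ctwo ^c natLeq"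
proof -
  have "|UNIV :: real set| =o |UNIV :: nat set set|"
    using nat_sets_eqpoll_reals unfolding eqpoll_def
    by (meson card_of_ordIso ordIso_symmetric)
  also have "|UNIV :: nat set set| =o |Pow (UNIV :: nat set)|"
    by (simp add: card_of_refl)
  also have "|Pow (UNIV :: nat set)| =o ctwo ^c |UNIV :: nat set|"
    unfolding ctwo_def cexp_def Field_card_of by (rule card_of_Pow_Func)
  also have "ctwo ^c |UNIV :: nat set| =o ctwo ^c natLeq"
    by (intro cexp_cong2 card_of_nat Card_order_ctwo card_of_Card_order natLeq_Card_order)
  finally show ?thesis .
qed

theorem theorem4:
  fixes M :: "'a measure" and E :: "'a rel"
  assumes "standard_borel M"
    and "countable_borel_equiv M E"
    and "aperiodic M E"
    and "\<not> smooth M E"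
  shows "distinguishing_number (space M) (E - Id_on (space M)) =o natLeq \<and>
         natLeq <o ctwo ^c natLeq \<and>
         ctwo ^c natLeq =o borel_distinguishing_number M (E - Id_on (space M))"
proof (intro conjI)
  have eq: "equiv (space M) E" and borel: "borel_equiv M E"
    using assms(2) by (auto simp: countable_borel_equiv_def borel_equiv_def)
  have classes: "countable C \<and> infinite C" if "C \<in> space M // E" for C
    using assms(2,3) that by (auto simp: countable_borel_equiv_def aperiodic_def)
  obtain r :: "'a \<Rightarrow> real" where r: "inj_on r (space M)"
    using assms(1) polish_topology_inj_real unfolding standard_borel_def by metis
  obtain x where x: "x \<in> space M"
    using smooth_if_empty[of M E] assms(4) by blast
  show "distinguishing_number (space M) (E - Id_on (space M)) =o natLeq"
  proof (rule ordIso_iff_ordLeq[THEN iffD2], rule conjI)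
    obtain c :: "'a \<Rightarrow> nat" where "distinguishing_coloring (space M) (E - Id_on (space M)) c"
      using exists_distinguishing_nat_coloring[OF eq classes r] by blast
    then have "distinguishing_number (space M) (E - Id_on (space M)) \<le>o |UNIV :: nat set|"
      by (intro distinguishing_number_le) auto
    then show "distinguishing_number (space M) (E - Id_on (space M)) \<le>o natLeq"
      using card_of_nat by (rule ordLeq_ordIso_trans)
    obtain I c where I: "distinguishing_number (space M) (E - Id_on (space M)) = |I :: 'a set|"
      "c \<in> space M \<rightarrow> I" "distinguishing_coloring (space M) (E - Id_on (space M)) c"
      using distinguishing_number_attained by metis
    have C: "E `` {x} \<in> space M // E"
      using x by (rule quotientI)
    have "infinite (c ` (E `` {x}))"
      using distinguishing_inj_on_class[OF eq I(3) C] classes[OF C] by (simp add: finite_image_iff)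
    moreover have "c ` (E `` {x}) \<subseteq> I"
      using I(2) in_quotient_imp_subset[OF eq C] by blast
    ultimately have "infinite I"
      using finite_subset by blast
    then show "natLeq \<le>o distinguishing_number (space M) (E - Id_on (space M))"
      unfolding I(1) using infinite_iff_natLeq_ordLeq by blast
  qed
  show "natLeq <o ctwo ^c natLeq"
    by (rule ordLess_ctwo_cexp[OF natLeq_Card_order])
  obtain N c where N: "borel_distinguishing_number M (E - Id_on (space M)) = |space N|"
    "standard_borel N" "c \<in> M \<rightarrow>\<^sub>M N" "distinguishing_coloring (space M) (E - Id_on (space M)) c"
    using borel_distinguishing_number_attained[OF assms(1)] by blast
  have "space N \<noteq> {}"
    using x measurable_space[OF N(3)] by blast
  then obtain d y where "polish_borel N d y"
    using standard_borel_imp_polish_borel[OF N(2)] by blast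
  moreover have "uncountable (space N)"
    using smooth_if_countably_many_colors[OF assms(1) borel N(2) _ N(3,4)] assms(4) by blast
  ultimately have "(UNIV :: real set) \<lesssim> space N"
    by (rule polish_borel.uncountable_imp_continuum)
  then have "|UNIV :: real set| \<le>o |space N|"
    unfolding lepoll_def by (meson card_of_ordLeq)
  moreover have "|space N| \<le>o |UNIV :: real set|"
    by (rule card_of_mono1) simp
  ultimately have "|UNIV :: real set| =o |space N|"
    by (simp add: ordIso_iff_ordLeq)
  then show "ctwo ^c natLeq =o borel_distinguishing_number M (E - Id_on (space M))"
    unfolding N(1) using card_of_reals ordIso_symmetric ordIso_transitive by blast
qed

end
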